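(* Let $G$ be a finite group and $\gamma$ a faithful $n$-dimensional complex representation of $G$ whose character $\chi_\gamma$ is real-valued. Let $c\in G$ be such that $\chi_\gamma(c)$ is an integer, and let $m$ be the number of conjugacy classes of $G$ on which $\chi_\gamma$ takes the value $\chi_\gamma(c)$. Then $K(\gamma)$ contains a subgroup isomorphic to $\bigl(\mathbb{Z}/(n-\chi_\gamma(c))\mathbb{Z}\bigr)^{m-1}$.
   Context: Let $G$ be a finite group with irreducible complex characters $\chi_0,\chi_1,\dots,\chi_\ell$, where $\chi_0$ is the trivial character (so $\ell+1$ is the number of conjugacy classes of $G$). For a faithful $n$-dimensional complex representation $\gamma$ of $G$ with character $\chi_\gamma$, let $M=(m_{ij})\in\mathbb{Z}^{(\ell+1)\times(\ell+1)}$ be defined by $\chi_\gamma\cdot\chi_i=\sum_{j=0}^{\ell}m_{ij}\chi_j$. The extended McKay–Cartan matrix is $\tilde C:=nI-M$, and the McKay–Cartan matrix $C$ is the $\ell\times\ell$ matrix obtained from $\tilde C$ by deleting the row and column indexed by $\chi_0$. The critical group of $\gamma$ is the finite abelian group $K(\gamma):=\operatorname{coker}(C^t:\mathbb{Z}^\ell\to\mathbb{Z}^\ell)$; equivalently $\operatorname{coker}(\tilde C^t:\mathbb{Z}^{\ell+1}\to\mathbb{Z}^{\ell+1})\cong\mathbb{Z}\oplus K(\gamma)$. *)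

theory Defs
  imports "HOL-Algebra.Algebra" "Jordan_Normal_Form.Matrix"
begin

definition mat_trace :: "'a::comm_ring_1 mat \<Rightarrow> 'a" where
  "mat_trace A = (\<Sum>i<dim_row A. A $$ (i, i))"

definition is_rep :: "('g, 'b) monoid_scheme \<Rightarrow> nat \<Rightarrow> ('g \<Rightarrow> complex mat) \<Rightarrow> bool" where
  "is_rep G d \<rho> \<longleftrightarrow>
     (\<forall>g \<in> carrier G. \<rho> g \<in> carrier_mat d d) \<and>
     \<rho> \<one>\<^bsub>G\<^esub> = 1\<^sub>m d \<and>
     (\<forall>g \<in> carrier G. \<forall>h \<in> carrier G. \<rho> (g \<otimes>\<^bsub>G\<^esub> h) = \<rho> g * \<rho> h)"

definition faithful_rep :: "('g, 'b) monoid_scheme \<Rightarrow> nat \<Rightarrow> ('g \<Rightarrow> complex mat) \<Rightarrow> bool" where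
  "faithful_rep G d \<rho> \<longleftrightarrow> is_rep G d \<rho> \<and> inj_on \<rho> (carrier G)"

definition is_subspace_vec :: "nat \<Rightarrow> complex vec set \<Rightarrow> bool" where
  "is_subspace_vec d W \<longleftrightarrow> W \<subseteq> carrier_vec d \<and> 0\<^sub>v d \<in> W \<and>
     (\<forall>v \<in> W. \<forall>w \<in> W. v + w \<in> W) \<and> (\<forall>a. \<forall>v \<in> W. a \<cdot>\<^sub>v v \<in> W)"

definition irreducible_rep :: "('g, 'b) monoid_scheme \<Rightarrow> nat \<Rightarrow> ('g \<Rightarrow> complex mat) \<Rightarrow> bool" where
  "irreducible_rep G d \<rho> \<longleftrightarrow> is_rep G d \<rho> \<and> d > 0 \<and>
     (\<forall>W. is_subspace_vec d W \<and> (\<forall>g \<in> carrier G. \<forall>w \<in> W. \<rho> g *\<^sub>v w \<in> W)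
          \<longrightarrow> W = {0\<^sub>v d} \<or> W = carrier_vec d)"

definition character :: "('g, 'b) monoid_scheme \<Rightarrow> ('g \<Rightarrow> complex mat) \<Rightarrow> 'g \<Rightarrow> complex" where
  "character G \<rho> = (\<lambda>g \<in> carrier G. mat_trace (\<rho> g))"

definition irr_chars :: "('g, 'b) monoid_scheme \<Rightarrow> ('g \<Rightarrow> complex) set" where
  "irr_chars G = {\<chi>. \<exists>d \<rho>. irreducible_rep G d \<rho> \<and> \<chi> = character G \<rho>}"

definition trivial_char :: "('g, 'b) monoid_scheme \<Rightarrow> 'g \<Rightarrow> complex" where
  "trivial_char G = (\<lambda>g \<in> carrier G. 1)"

definition conj_classes :: "('g, 'b) monoid_scheme \<Rightarrow> 'g set set" where
  "conj_classes G = (\<lambda>g. {inv\<^bsub>G\<^esub> h \<otimes>\<^bsub>G\<^esub> g \<otimes>\<^bsub>G\<^esub> h | h. h \<in> carrier G}) ` carrier G"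

text \<open>Irreducible characters are indexed by 0..l (index 0 = trivial character);
  M is the integer matrix (indexed by nat) with chi_gamma * chi_i = sum_j M i j * chi_j.
  Extended McKay-Cartan matrix: n I - M.  The McKay-Cartan matrix C is its restriction
  to the indices 1..l.\<close>
definition ext_mckay_cartan :: "nat \<Rightarrow> (nat \<Rightarrow> nat \<Rightarrow> int) \<Rightarrow> nat \<Rightarrow> nat \<Rightarrow> int" where
  "ext_mckay_cartan n M i j = (if i = j then int n else 0) - M i j"

definition int_lattice :: "nat \<Rightarrow> (nat \<Rightarrow> int) monoid" where
  "int_lattice l = \<lparr>carrier = {x. \<forall>i. i \<notin> {1..l} \<longrightarrow> x i = 0},
                    monoid.mult = (\<lambda>x y i. x i + y i), one = (\<lambda>_. 0)\<rparr>"

definition mckay_cartan_transpose_image :: "nat \<Rightarrow> nat \<Rightarrow> (nat \<Rightarrow> nat \<Rightarrow> int) \<Rightarrow> (nat \<Rightarrow> int) set" where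
  "mckay_cartan_transpose_image l n M =
     (\<lambda>x. (\<lambda>i. if i \<in> {1..l} then (\<Sum>j\<in>{1..l}. ext_mckay_cartan n M j i * x j) else 0))
       ` carrier (int_lattice l)"

definition critical_group :: "nat \<Rightarrow> nat \<Rightarrow> (nat \<Rightarrow> nat \<Rightarrow> int) \<Rightarrow> (nat \<Rightarrow> int) set monoid" where
  "critical_group l n M = int_lattice l Mod mckay_cartan_transpose_image l n M"

end

theory Submission
  imports Defs "Jordan_Normal_Form.Spectral_Radius"
begin

text \<open>Since the character of \<open>\<gamma>\<close> is real, \<open>M\<close> is symmetric. For each conjugacy class on which the
  character takes the value \<open>z\<close>, the corresponding column of the character table is an eigenvector of
  \<open>M\<close> for \<open>z\<close>, and these columns are linearly independent. As \<open>M\<close> and \<open>z\<close> are integral, the lattice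
  \<open>E\<close> of integer vectors \<open>x\<close> that vanish at the trivial character and satisfy \<open>C\<^sup>t x = k x\<close>, where
  \<open>k = n - z\<close>, has rank at least \<open>m - 1\<close>.

  By faithfulness \<open>C\<^sup>t\<close> is injective. Hence if \<open>x \<in> E\<close> and \<open>x = C\<^sup>t y\<close>, then
  \<open>C\<^sup>t (k y) = k x = C\<^sup>t x\<close> yields \<open>x = k y\<close> and \<open>y \<in> E\<close>. So the intersection of \<open>E\<close> with the image
  of \<open>C\<^sup>t\<close> is \<open>k E\<close>, and the image of \<open>E\<close> in the cokernel is \<open>E / k E\<close>.\<close>

section \<open>Linear algebra over the integers\<close>

text \<open>The equation defining \<open>M\<close>, read at one g, makes the column of values
  chi_i(g) an eigenvector of \<open>M\<close>, whereas the critical group is a cokernel of a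
  transpose; this is why symmetry matters. Independence of the columns comes from completeness of
  the irreducible characters: a class function orthogonal to all of them is zero.

  The exponent is m - 1 because \<open>C\<close> lacks the trivial index: only combinations of the m
  columns that vanish there are usable, which costs one dimension. The columns are complex, but
  lattice vectors are wanted; a rational functional on the complex numbers turns eigenvectors into
  rational ones without destroying zero entries.

  Faithfulness acts through one fact: the character takes the value n only at the identity. For z =
  n the cyclic group Z/0 is Z, but then m = 1 and no factor occurs.\<close>

lemma underdetermined_system:
  fixes a :: "'i \<Rightarrow> 't \<Rightarrow> 'a::field"
  assumes "finite S" "finite T" "card S < card T"
  shows "\<exists>f. (\<exists>t\<in>T. f t \<noteq> 0) \<and> (\<forall>i\<in>S. (\<Sum>t\<in>T. a i t * f t) = 0)"
  using assms
proof (induction S arbitrary: a T rule: finite_induct)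
  case empty
  then have "T \<noteq> {}" by auto
  then show ?case by (intro exI[of _ "\<lambda>_. 1"]) auto
next
  case (insert s S)
  show ?case
  proof (cases "\<forall>t\<in>T. a s t = 0")
    case True
    from insert.IH[of T a] insert.prems insert.hyps
    obtain f where "\<exists>t\<in>T. f t \<noteq> 0" "\<forall>i\<in>S. (\<Sum>t\<in>T. a i t * f t) = 0" by auto
    then show ?thesis using True by (intro exI[of _ f]) auto
  next
    case False
    then obtain t0 where t0: "t0 \<in> T" "a s t0 \<noteq> 0" by auto
    have "card S < card (T - {t0})" using insert t0 by simp
    \<comment> \<open>Gaussian elimination: equation \<open>s\<close> is solved for the unknown
      \<open>t0\<close> and substituted into the others. Below, \<open>g\<close> restores the
      eliminated coordinate.\<close>
    from insert.IH[OF _ this, of "\<lambda>i t. a i t - a i t0 * a s t / a s t0"] insert.prems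
    obtain f where f: "\<exists>t\<in>T - {t0}. f t \<noteq> 0"
      "\<forall>i\<in>S. (\<Sum>t\<in>T - {t0}. (a i t - a i t0 * a s t / a s t0) * f t) = 0" by auto
    define g where "g = f(t0 := - (\<Sum>t\<in>T - {t0}. a s t * f t) / a s t0)"
    have split: "(\<Sum>t\<in>T. a i t * g t) = a i t0 * g t0 + (\<Sum>t\<in>T - {t0}. a i t * f t)" for i
    proof -
      have "(\<Sum>t\<in>T - {t0}. a i t * g t) = (\<Sum>t\<in>T - {t0}. a i t * f t)"
        by (rule sum.cong) (auto simp: g_def)
      then show ?thesis using insert.prems t0 by (simp add: sum.remove)
    qed
    have "(\<Sum>t\<in>T. a i t * g t) = 0" if "i \<in> S" for i
    proof -
      have "0 = (\<Sum>t\<in>T - {t0}. a i t * f t) - (\<Sum>t\<in>T - {t0}. a i t0 / a s t0 * (a s t * f t))"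
        using f(2) that unfolding sum_subtractf[symmetric] by (simp add: algebra_simps)
      also have "\<dots> = (\<Sum>t\<in>T - {t0}. a i t * f t) + a i t0 * g t0"
        by (simp add: g_def sum_distrib_left sum_divide_distrib)
      finally show ?thesis unfolding split by (simp add: add.commute)
    qed
    moreover have "(\<Sum>t\<in>T. a s t * g t) = 0"
      unfolding split using t0 by (simp add: g_def)
    moreover have "\<exists>t\<in>T. g t \<noteq> 0" using f(1) by (auto simp: g_def)
    ultimately show ?thesis by (intro exI[of _ g]) auto
  qed
qed

text \<open>A rational-linear functional \<open>\<phi>\<close> from the complex numbers to the
  rationals commutes with the integer matrix \<open>B\<close>, so applying it entrywise keeps
  \<open>v\<close> in the kernel, and it sends zeros to zeros. Taking for \<open>\<phi>\<close> the
  coordinate at a Hamel basis element that occurs in \<open>v j0\<close> keeps the vector nonzero;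
  then denominators are cleared.\<close>

lemma integer_kernel_vector:
  fixes B :: "'i \<Rightarrow> 'j \<Rightarrow> int" and v :: "'j \<Rightarrow> complex"
  assumes fin: "finite J" and j0: "j0 \<in> J" "v j0 \<noteq> 0"
    and ker: "\<And>i. i \<in> I \<Longrightarrow> (\<Sum>j\<in>J. of_int (B i j) * v j) = 0"
  shows "\<exists>y. (\<exists>j\<in>J. y j \<noteq> 0) \<and> (\<forall>j. v j = 0 \<longrightarrow> y j = 0) \<and> (\<forall>i\<in>I. (\<Sum>j\<in>J. B i j * y j) = 0)"
proof -
  interpret Q: vector_space "\<lambda>(q::rat) (x::complex). of_rat q * x"
    by unfold_locales (auto simp: algebra_simps of_rat_add of_rat_mult)
  obtain b where b: "Q.independent b" "Q.span b = UNIV"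
    using Q.basis_exists[of UNIV] by (metis top.extremum_unique)
  have "Q.representation b (v j0) \<noteq> (\<lambda>_. 0)"
  proof
    assume "Q.representation b (v j0) = (\<lambda>_. 0)"
    then have "v j0 = 0" using Q.sum_nonzero_representation_eq[OF b(1), of "v j0"] b(2) by simp
    then show False using j0 by simp
  qed
  then obtain e where e: "Q.representation b (v j0) e \<noteq> 0" by auto
  define \<phi> where "\<phi> x = Q.representation b x e" for x
  have \<phi>_add: "\<phi> (x + y) = \<phi> x + \<phi> y" for x y
    using Q.representation_add[OF b(1), of y x] b(2) by (simp add: \<phi>_def)
  have \<phi>_scale: "\<phi> (of_rat q * x) = q * \<phi> x" for q x
    using Q.representation_scale[OF b(1), of x q] b(2) by (simp add: \<phi>_def)
  have \<phi>_0: "\<phi> 0 = 0" using \<phi>_scale[of 0 0] by simp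
  have \<phi>_sum: "\<phi> (\<Sum>j\<in>K. f j) = (\<Sum>j\<in>K. \<phi> (f j))" for f :: "'j \<Rightarrow> complex" and K
    by (induction K rule: infinite_finite_induct) (auto simp: \<phi>_0 \<phi>_add)
  have ker': "(\<Sum>j\<in>J. of_int (B i j) * \<phi> (v j)) = 0" if "i \<in> I" for i
  proof -
    have "0 = \<phi> (\<Sum>j\<in>J. of_rat (of_int (B i j)) * v j)"
      using ker[OF that] by (simp add: \<phi>_0)
    then show ?thesis by (simp only: \<phi>_sum \<phi>_scale)
  qed
  have "\<exists>D::int. D \<noteq> 0 \<and> (\<forall>j\<in>J. of_int D * \<phi> (v j) \<in> \<int>)"
  proof -
    have "\<exists>D::int. D \<noteq> 0 \<and> (\<forall>j\<in>K. of_int D * \<phi> (v j) \<in> \<int>)" if "finite K" for K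
      using that
    proof (induction K rule: finite_induct)
      case empty
      show ?case by (intro exI[of _ 1]) auto
    next
      case (insert x K)
      then obtain D :: int where D: "D \<noteq> 0" "\<forall>j\<in>K. of_int D * \<phi> (v j) \<in> \<int>" by auto
      obtain p q where pq: "quotient_of (\<phi> (v x)) = (p, q)" by fastforce
      have q: "q > 0" "\<phi> (v x) = of_int p / of_int q"
        using quotient_of_denom_pos[OF pq] quotient_of_div[OF pq] by auto
      have "of_int (q * D) * \<phi> (v j) \<in> \<int>" if "j \<in> insert x K" for j
      proof (cases "j = x")
        case True
        then have "of_int (q * D) * \<phi> (v j) = of_int (D * p)" using q by simp
        then show ?thesis by (metis Ints_of_int)
      next
        case False
        then have "of_int D * \<phi> (v j) \<in> \<int>" using D that by auto
        then have "of_int q * (of_int D * \<phi> (v j)) \<in> \<int>" by (rule Ints_mult[OF Ints_of_int])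
        then show ?thesis by (simp add: mult.assoc)
      qed
      then show ?case using D q by (intro exI[of _ "q * D"]) auto
    qed
    then show ?thesis using fin by blast
  qed
  then obtain D :: int where D: "D \<noteq> 0" "\<forall>j\<in>J. of_int D * \<phi> (v j) \<in> \<int>" by auto
  \<comment> \<open>The floor is exact on \<open>J\<close>, where the argument is an integer.
    Elsewhere it still maps zero entries of \<open>v\<close> to 0.\<close>
  define y where "y j = \<lfloor>of_int D * \<phi> (v j)\<rfloor>" for j
  have y: "of_int (y j) = of_int D * \<phi> (v j)" if "j \<in> J" for j
    using D(2) that by (auto simp: y_def elim!: Ints_cases)
  have "(\<Sum>j\<in>J. B i j * y j) = 0" if "i \<in> I" for i
  proof -
    have "(of_int (\<Sum>j\<in>J. B i j * y j) :: rat) = (\<Sum>j\<in>J. of_int D * (of_int (B i j) * \<phi> (v j)))"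
      by (simp add: y algebra_simps)
    also have "\<dots> = 0" unfolding sum_distrib_left[symmetric] by (simp add: ker'[OF that])
    finally show ?thesis by (simp only: of_int_eq_0_iff)
  qed
  moreover have "y j0 \<noteq> 0"
    using y[OF j0(1)] D(1) e by (auto simp: \<phi>_def)
  moreover have "y j = 0" if "v j = 0" for j by (simp add: y_def that \<phi>_0)
  ultimately show ?thesis using j0 by (intro exI[of _ y]) auto
qed

text \<open>The rank hypothesis says that fewer than \<open>r\<close> coordinates never suffice to make an element of
  the lattice vanish; unlike a dimension it is inherited directly by the sublattice where one
  coordinate is zero.\<close>

lemma saturated_lattice_basis:
  fixes E :: "('i \<Rightarrow> int) set"
  assumes lin: "\<And>x y a b. x \<in> E \<Longrightarrow> y \<in> E \<Longrightarrow> (\<lambda>i. a * x i + b * y i) \<in> E"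
    and rank: "\<And>S. finite S \<Longrightarrow> card S < r \<Longrightarrow> \<exists>x\<in>E. (\<exists>i. x i \<noteq> 0) \<and> (\<forall>i\<in>S. x i = 0)"
  shows "\<exists>w. (\<forall>j<r. w j \<in> E) \<and>
    (\<forall>k u a. u \<in> E \<longrightarrow> (\<forall>i. (\<Sum>j<r. a j * w j i) = k * u i) \<longrightarrow> (\<forall>j<r. k dvd a j))"
  using assms
proof (induction r arbitrary: E)
  case 0
  show ?case by simp
next
  case (Suc r)
  obtain x p where x: "x \<in> E" "x p \<noteq> 0" using Suc.prems(2)[of "{}"] by auto
  have "(\<lambda>i. sgn (x p) * x i + 0 * x i) \<in> E" using Suc.prems(1)[OF x(1) x(1)] .
  moreover have "sgn (x p) * x p > 0" using x(2) by (simp add: sgn_if)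
  ultimately have ex: "\<exists>y. y \<in> E \<and> y p > 0" by force
  \<comment> \<open>Euclid's argument: a vector of \<open>E\<close> with least positive entry at
    \<open>p\<close> has an entry dividing those of all others, since remainders stay in
    \<open>E\<close>.\<close>
  obtain v where v: "v \<in> E" "v p > 0" and min: "\<And>y. y \<in> E \<Longrightarrow> y p > 0 \<Longrightarrow> nat (v p) \<le> nat (y p)"
    using ex
      arg_min_natI[of "\<lambda>y. y \<in> E \<and> y p > 0" _ "\<lambda>y. nat (y p)"]
      arg_min_nat_le[of "\<lambda>y. y \<in> E \<and> y p > 0" _ "\<lambda>y. nat (y p)"] by blast
  have dvd: "v p dvd u p" if "u \<in> E" for u
  proof -
    have "(\<lambda>i. 1 * u i + (- (u p div v p)) * v i) \<in> E" using Suc.prems(1)[OF that v(1)] .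
    then have mem: "(\<lambda>i. u i - (u p div v p) * v i) \<in> E" by simp
    have eq: "u p - (u p div v p) * v p = u p mod v p" by (simp add: minus_div_mult_eq_mod)
    have "\<not> u p mod v p > 0"
    proof
      assume pos: "u p mod v p > 0"
      then have "nat (v p) \<le> nat (u p mod v p)" using min[OF mem] eq by simp
      then show False using pos pos_mod_bound[OF v(2), of "u p"] by simp
    qed
    then have "u p mod v p = 0" using pos_mod_sign[OF v(2), of "u p"] by simp
    then show ?thesis by auto
  qed
  define F where "F = {u \<in> E. u p = 0}"
  have "\<exists>w. (\<forall>j<r. w j \<in> F) \<and>
    (\<forall>k u a. u \<in> F \<longrightarrow> (\<forall>i. (\<Sum>j<r. a j * w j i) = k * u i) \<longrightarrow> (\<forall>j<r. k dvd a j))"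
  proof (rule Suc.IH)
    show "(\<lambda>i. a * x i + b * y i) \<in> F" if "x \<in> F" "y \<in> F" for x y a b
      using that Suc.prems(1) by (auto simp: F_def)
    show "\<exists>x\<in>F. (\<exists>i. x i \<noteq> 0) \<and> (\<forall>i\<in>S. x i = 0)" if "finite S" "card S < r" for S
    proof -
      have "card (insert p S) < Suc r" using that by (simp add: card_insert_if)
      then show ?thesis using Suc.prems(2)[of "insert p S"] that by (auto simp: F_def)
    qed
  qed
  then obtain w where w: "\<And>j. j < r \<Longrightarrow> w j \<in> F"
    "\<And>k u a j. u \<in> F \<Longrightarrow> (\<forall>i. (\<Sum>j<r. a j * w j i) = k * u i) \<Longrightarrow> j < r \<Longrightarrow> k dvd a j"
    by blast
  define w' where "w' = w(r := v)"
  have "k dvd a j" if u: "u \<in> E" and eq: "\<forall>i. (\<Sum>j<Suc r. a j * w' j i) = k * u i" and j: "j < Suc r"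
    for k u a j
  proof -
    \<comment> \<open>The entry at \<open>p\<close> involves only \<open>v\<close>, because the
      other vectors vanish there; this fixes \<open>a r\<close>. Subtracting the matching multiple
      of \<open>v\<close> from \<open>u\<close> moves the relation into \<open>F\<close>.\<close>
    have eq': "(\<Sum>j<r. a j * w j i) + a r * v i = k * u i" for i
      using eq by (simp add: w'_def)
    have "(\<Sum>j<r. a j * w j p) = 0" using w(1) by (intro sum.neutral) (auto simp: F_def)
    with eq'[of p] have p: "a r * v p = k * u p" by simp
    obtain b where b: "u p = v p * b" using dvd[OF u] by blast
    have ar: "a r = k * b" using p v(2) by (simp add: b)
    have "(\<lambda>i. 1 * u i + (- b) * v i) \<in> E" using Suc.prems(1)[OF u v(1)] .
    then have "(\<lambda>i. u i - b * v i) \<in> F" by (simp add: F_def b)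
    moreover have "\<forall>i. (\<Sum>j<r. a j * w j i) = k * (u i - b * v i)"
      using eq' by (simp add: ar algebra_simps eq_diff_eq)
    ultimately have "k dvd a j" if "j < r" using w(2) that by blast
    then show ?thesis using j ar by (cases "j = r") auto
  qed
  moreover have "w' j \<in> E" if "j < Suc r" for j
    using that w(1) v(1) by (cases "j = r") (auto simp: w'_def F_def)
  ultimately show ?case by (intro exI[of _ w']) blast
qed

section \<open>Complex matrices\<close>

lemma mat_trace_comm:
  fixes A :: "'a::comm_ring_1 mat"
  assumes "A \<in> carrier_mat n m" "B \<in> carrier_mat m n"
  shows "mat_trace (A * B) = mat_trace (B * A)"
proof -
  have "mat_trace (A * B) = (\<Sum>i<n. \<Sum>k<m. A $$ (i, k) * B $$ (k, i))"
    using assms by (auto simp: mat_trace_def scalar_prod_def lessThan_atLeast0)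
  also have "\<dots> = (\<Sum>k<m. \<Sum>i<n. B $$ (k, i) * A $$ (i, k))"
    by (subst sum.swap) (simp add: mult.commute)
  also have "\<dots> = mat_trace (B * A)"
    using assms by (auto simp: mat_trace_def scalar_prod_def lessThan_atLeast0)
  finally show ?thesis .
qed

lemma mat_trace_one [simp]: "mat_trace (1\<^sub>m n) = of_nat n"
  by (simp add: mat_trace_def)

lemma upper_triangular_mult_entry:
  fixes A :: "'a::comm_ring_1 mat"
  assumes "A \<in> carrier_mat n n" "B \<in> carrier_mat n n" "upper_triangular A" "upper_triangular B"
    and "i < n" "j < n"
  shows "(A * B) $$ (i, j) = (\<Sum>m\<in>{i..j}. A $$ (i, m) * B $$ (m, j))"
proof -
  have "(A * B) $$ (i, j) = (\<Sum>m\<in>{0..<n}. A $$ (i, m) * B $$ (m, j))"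
    using assms by (auto simp: scalar_prod_def)
  also have "\<dots> = (\<Sum>m\<in>{i..j}. A $$ (i, m) * B $$ (m, j))"
  proof (rule sum.mono_neutral_right)
    show "\<forall>m\<in>{0..<n} - {i..j}. A $$ (i, m) * B $$ (m, j) = 0"
    proof
      fix m assume "m \<in> {0..<n} - {i..j}"
      then have "m < i \<or> j < m" "m < n" by auto
      then show "A $$ (i, m) * B $$ (m, j) = 0"
        using upper_triangularD[OF assms(3), of m i] upper_triangularD[OF assms(4), of j m] assms
        by auto
    qed
  qed (use assms in auto)
  finally show ?thesis .
qed

lemma upper_triangular_pow:
  fixes B :: "'a::comm_ring_1 mat"
  assumes B: "B \<in> carrier_mat n n" "upper_triangular B"
  shows "upper_triangular (B ^\<^sub>m k)" "i < n \<Longrightarrow> (B ^\<^sub>m k) $$ (i, i) = B $$ (i, i) ^ k"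
proof -
  have "upper_triangular (B ^\<^sub>m k) \<and> (\<forall>i<n. (B ^\<^sub>m k) $$ (i, i) = B $$ (i, i) ^ k)"
  proof (induction k)
    case 0
    then show ?case using B by (auto simp: one_mat_def)
  next
    case (Suc k)
    have C: "B ^\<^sub>m k \<in> carrier_mat n n" using B by auto
    note entry = upper_triangular_mult_entry[OF C B(1) conjunct1[OF Suc] B(2)]
    show ?case
    proof (intro conjI allI impI)
      show "upper_triangular (B ^\<^sub>m Suc k)"
        using entry B by (intro upper_triangularI) (auto simp: pow_mat_dim_square)
      show "(B ^\<^sub>m Suc k) $$ (i, i) = B $$ (i, i) ^ Suc k" if "i < n" for i
        using entry[OF that that] Suc that by simp
    qed
  qed
  then show "upper_triangular (B ^\<^sub>m k)" "i < n \<Longrightarrow> (B ^\<^sub>m k) $$ (i, i) = B $$ (i, i) ^ k"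
    by auto
qed

text \<open>Induction on the distance \<open>j - i\<close> from the diagonal: if all closer entries of \<open>B\<close> vanish,
  then the \<open>(i, j)\<close> entry of \<open>B\<^sup>k\<close> is \<open>k\<close> times that of \<open>B\<close>.\<close>

lemma upper_unitriangular_finite_order:
  fixes B :: "'a::field_char_0 mat"
  assumes B: "B \<in> carrier_mat n n" "upper_triangular B" "\<And>i. i < n \<Longrightarrow> B $$ (i, i) = 1"
    and N: "B ^\<^sub>m N = 1\<^sub>m n" "N > 0"
  shows "B = 1\<^sub>m n"
proof -
  have "B $$ (i, j) = 0" if "i < j" "j < n" for i j
    using that
  proof (induction "j - i" arbitrary: i j rule: less_induct)
    case less
    have "(B ^\<^sub>m k) $$ (i, j) = of_nat k * B $$ (i, j)" for k
    proof (induction k)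
      case 0
      then show ?case using less.prems B by auto
    next
      case (Suc k)
      have C: "B ^\<^sub>m k \<in> carrier_mat n n" using B by auto
      have mid: "(B ^\<^sub>m k) $$ (i, m) * B $$ (m, j) = 0" if "m \<in> {i..j} - {i, j}" for m
      proof -
        have "i < m" "m < j" using that by auto
        then show ?thesis using less.hyps[of j m] less.prems by simp
      qed
      have "(B ^\<^sub>m Suc k) $$ (i, j) = (\<Sum>m\<in>{i..j}. (B ^\<^sub>m k) $$ (i, m) * B $$ (m, j))"
        using upper_triangular_mult_entry[OF C B(1) upper_triangular_pow(1)[OF B(1,2)] B(2)]
          less.prems by simp
      also have "\<dots> = (\<Sum>m\<in>{i, j}. (B ^\<^sub>m k) $$ (i, m) * B $$ (m, j))"
        using mid less.prems by (intro sum.mono_neutral_right) auto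
      also have "\<dots> = of_nat (Suc k) * B $$ (i, j)"
        using less.prems upper_triangular_pow(2)[OF B(1,2), of i k] Suc B(3) by (simp add: algebra_simps)
      finally show ?case .
    qed
    \<comment> \<open>At the exponent \<open>N\<close> the entry is that of the identity, so N times
      the entry of \<open>B\<close> is 0, and the characteristic is 0.\<close>
    from this[of N] show ?case using N less.prems by simp
  qed
  then show ?thesis using B upper_triangularD[OF B(2)]
    by (intro eq_matI) (auto, metis nat_neq_iff)
qed

text \<open>Schur triangularisation takes the place of diagonalisation: \<open>ev\<close> is the
  diagonal of the triangular form, from which traces of powers are read off. The last clause, on
  matrices of finite order with all eigenvalues 1, is what later exploits faithfulness.\<close>

lemma complex_mat_spectrum:
  assumes A: "(A :: complex mat) \<in> carrier_mat n n"
  obtains ev where "\<And>k. mat_trace (A ^\<^sub>m k) = (\<Sum>i<n. ev i ^ k)"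
    "\<And>i. i < n \<Longrightarrow> eigenvalue A (ev i)"
    "\<And>N. N > 0 \<Longrightarrow> A ^\<^sub>m N = 1\<^sub>m n \<Longrightarrow> (\<And>i. i < n \<Longrightarrow> ev i = 1) \<Longrightarrow> A = 1\<^sub>m n"
proof -
  obtain es where es: "char_poly A = (\<Prod>a\<leftarrow>es. [:- a, 1:])" "length es = n"
    using char_poly_factorized[OF A] by auto
  obtain B P Q where BPQ: "schur_decomposition A es = (B, P, Q)"
    by (cases "schur_decomposition A es") auto
  note sd = schur_decomposition[OF A es(1) BPQ]
  from sd have sim: "similar_mat_wit A B P Q" and B: "upper_triangular B" and diag: "diag_mat B = es"
    by auto
  note w = similar_mat_witD2[OF A sim]
  have ev: "B $$ (i, i) = es ! i" if "i < n" for i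
    using diag[symmetric] that w(5) by (simp add: diag_mat_def)
  have pow: "A ^\<^sub>m k = P * B ^\<^sub>m k * Q" for k by (rule similar_mat_wit_pow_id[OF sim])
  have "mat_trace (A ^\<^sub>m k) = (\<Sum>i<n. B $$ (i, i) ^ k)" for k
  proof -
    have Bk: "B ^\<^sub>m k \<in> carrier_mat n n" using w by auto
    have "mat_trace (A ^\<^sub>m k) = mat_trace (Q * (P * B ^\<^sub>m k))"
      unfolding pow using w Bk by (intro mat_trace_comm[of _ n n]) auto
    also have "Q * (P * B ^\<^sub>m k) = B ^\<^sub>m k"
      using w Bk assoc_mult_mat[OF w(7) w(6) Bk] by simp
    also have "mat_trace (B ^\<^sub>m k) = (\<Sum>i<n. B $$ (i, i) ^ k)"
      using Bk w(5) upper_triangular_pow(2)[OF w(5) B] by (simp add: mat_trace_def)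
    finally show ?thesis .
  qed
  moreover have "eigenvalue A (B $$ (i, i))" if "i < n" for i
  proof -
    have "B $$ (i, i) \<in> set es" using that ev es(2) by simp
    then show ?thesis unfolding eigenvalue_root_char_poly[OF A] es(1)
      by (auto simp: poly_prod_list prod_list_zero_iff)
  qed
  moreover have "A = 1\<^sub>m n" if "N > 0" "A ^\<^sub>m N = 1\<^sub>m n" "\<And>i. i < n \<Longrightarrow> B $$ (i, i) = 1" for N
  proof -
    have Bk: "B ^\<^sub>m N \<in> carrier_mat n n" using w by auto
    have "Q * (A ^\<^sub>m N) * P = (Q * P) * B ^\<^sub>m N * (Q * P)"
      unfolding pow using w(6,7) Bk
      by (smt (verit) assoc_mult_mat mult_carrier_mat)
    then have "B ^\<^sub>m N = 1\<^sub>m n" using w Bk that(2) by simp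
    then have "B = 1\<^sub>m n"
      using upper_unitriangular_finite_order[OF w(5) B] that by auto
    then show ?thesis using w by simp
  qed
  ultimately show ?thesis using that[of "\<lambda>i. B $$ (i, i)"] by blast
qed

lemma mult_mat_zero_vec [simp]:
  "(A :: 'a::comm_ring_1 mat) \<in> carrier_mat n m \<Longrightarrow> A *\<^sub>v 0\<^sub>v m = 0\<^sub>v n"
  by (intro eq_vecI) auto

lemma vec_add_neg:
  "(v :: 'a::comm_ring_1 vec) \<in> carrier_vec n \<Longrightarrow> v + (- 1) \<cdot>\<^sub>v v = 0\<^sub>v n"
  by (intro eq_vecI) auto

lemma smult_one_mult_vec:
  fixes v :: "'a::comm_ring_1 vec"
  assumes "v \<in> carrier_vec n"
  shows "(k \<cdot>\<^sub>m 1\<^sub>m n) *\<^sub>v v = k \<cdot>\<^sub>v v"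
proof (rule eq_vecI)
  fix i assume "i < dim_vec (k \<cdot>\<^sub>v v)"
  then have i: "i < n" using assms by simp
  then have "((k \<cdot>\<^sub>m 1\<^sub>m n) *\<^sub>v v) $ i = (\<Sum>j\<in>{0..<n}. k * (if j = i then 1 else 0) * v $ j)"
    using assms by (auto simp: scalar_prod_def)
  also have "\<dots> = (\<Sum>j\<in>{0..<n}. if j = i then k * v $ j else 0)" by (intro sum.cong) auto
  finally show "((k \<cdot>\<^sub>m 1\<^sub>m n) *\<^sub>v v) $ i = (k \<cdot>\<^sub>v v) $ i" using i assms by simp
qed (use assms in simp)

lemma mat_eq_on_vecI:
  fixes A B :: "'a::comm_ring_1 mat"
  assumes A: "A \<in> carrier_mat n m" and B: "B \<in> carrier_mat n m"
    and eq: "\<And>v. v \<in> carrier_vec m \<Longrightarrow> A *\<^sub>v v = B *\<^sub>v v"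
  shows "A = B"
proof (rule eq_matI)
  fix i j assume ij: "i < dim_row B" "j < dim_col B"
  have *: "(C *\<^sub>v unit_vec m j) $ i = C $$ (i, j)" if "C \<in> carrier_mat n m" for C :: "'a mat"
    using that ij B by (simp add: scalar_prod_right_unit)
  show "A $$ (i, j) = B $$ (i, j)"
    using *[OF A] *[OF B] eq[of "unit_vec m j"] by simp
qed (use A B in auto)

lemma mat_eq_zero_on_vecI:
  fixes A :: "'a::comm_ring_1 mat"
  assumes A: "A \<in> carrier_mat n m" and eq: "\<And>v. v \<in> carrier_vec m \<Longrightarrow> A *\<^sub>v v = 0\<^sub>v n"
  shows "A = 0\<^sub>m n m"
proof (rule mat_eq_on_vecI[OF A zero_carrier_mat])
  fix v :: "'a vec" assume "v \<in> carrier_vec m"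
  moreover from this have "0\<^sub>m n m *\<^sub>v v = 0\<^sub>v n" by (intro eq_vecI) (auto simp: scalar_prod_def)
  ultimately show "A *\<^sub>v v = 0\<^sub>m n m *\<^sub>v v" using eq by simp
qed

section \<open>Finite sums of matrices\<close>

text \<open>Matrices of all sizes share one type with no common zero, so the dimensions are
  parameters and the sum is taken entrywise.\<close>

definition mat_sum :: "nat \<Rightarrow> nat \<Rightarrow> ('i \<Rightarrow> 'a::comm_ring_1 mat) \<Rightarrow> 'i set \<Rightarrow> 'a mat" where
  "mat_sum d e F A = mat d e (\<lambda>(i, j). \<Sum>g\<in>A. F g $$ (i, j))"

lemma mat_sum_carrier [simp, intro]: "mat_sum d e F A \<in> carrier_mat d e"
  by (simp add: mat_sum_def)

lemma mat_sum_cong: "(\<And>g. g \<in> A \<Longrightarrow> F g = F' g) \<Longrightarrow> mat_sum d e F A = mat_sum d e F' A"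
  by (auto simp: mat_sum_def)

lemma mat_sum_reindex:
  "bij_betw \<pi> A B \<Longrightarrow> mat_sum d e (\<lambda>g. F (\<pi> g)) A = mat_sum d e F B"
  by (auto simp: mat_sum_def intro!: eq_matI sum.reindex_bij_betw)

lemma mult_mat_sum:
  assumes B: "B \<in> carrier_mat m d" and F: "\<And>g. g \<in> A \<Longrightarrow> F g \<in> carrier_mat d e"
  shows "B * mat_sum d e F A = mat_sum m e (\<lambda>g. B * F g) A"
proof (rule eq_matI)
  fix i j assume "i < dim_row (mat_sum m e (\<lambda>g. B * F g) A)" "j < dim_col (mat_sum m e (\<lambda>g. B * F g) A)"
  then have ij: "i < m" "j < e" by (auto simp: mat_sum_def)
  have "(B * mat_sum d e F A) $$ (i, j) = (\<Sum>k\<in>{0..<d}. \<Sum>g\<in>A. B $$ (i, k) * F g $$ (k, j))"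
    using ij B by (simp add: mat_sum_def scalar_prod_def sum_distrib_left)
  also have "\<dots> = (\<Sum>g\<in>A. \<Sum>k\<in>{0..<d}. B $$ (i, k) * F g $$ (k, j))" by (rule sum.swap)
  also have "\<dots> = (\<Sum>g\<in>A. (B * F g) $$ (i, j))"
  proof (rule sum.cong)
    fix g assume "g \<in> A"
    from F[OF this] show "(\<Sum>k\<in>{0..<d}. B $$ (i, k) * F g $$ (k, j)) = (B * F g) $$ (i, j)"
      using ij B by (simp add: scalar_prod_def)
  qed simp
  finally show "(B * mat_sum d e F A) $$ (i, j) = mat_sum m e (\<lambda>g. B * F g) A $$ (i, j)"
    using ij by (simp add: mat_sum_def)
qed (use B in \<open>auto simp: mat_sum_def\<close>)

lemma mat_sum_mult:
  assumes B: "B \<in> carrier_mat e m" and F: "\<And>g. g \<in> A \<Longrightarrow> F g \<in> carrier_mat d e"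
  shows "mat_sum d e F A * B = mat_sum d m (\<lambda>g. F g * B) A"
proof (rule eq_matI)
  fix i j assume "i < dim_row (mat_sum d m (\<lambda>g. F g * B) A)" "j < dim_col (mat_sum d m (\<lambda>g. F g * B) A)"
  then have ij: "i < d" "j < m" by (auto simp: mat_sum_def)
  have "(mat_sum d e F A * B) $$ (i, j) = (\<Sum>k\<in>{0..<e}. \<Sum>g\<in>A. F g $$ (i, k) * B $$ (k, j))"
    using ij B by (simp add: mat_sum_def scalar_prod_def sum_distrib_right)
  also have "\<dots> = (\<Sum>g\<in>A. \<Sum>k\<in>{0..<e}. F g $$ (i, k) * B $$ (k, j))" by (rule sum.swap)
  also have "\<dots> = (\<Sum>g\<in>A. (F g * B) $$ (i, j))"
  proof (rule sum.cong)
    fix g assume "g \<in> A"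
    from F[OF this] show "(\<Sum>k\<in>{0..<e}. F g $$ (i, k) * B $$ (k, j)) = (F g * B) $$ (i, j)"
      using ij B by (simp add: scalar_prod_def)
  qed simp
  finally show "(mat_sum d e F A * B) $$ (i, j) = mat_sum d m (\<lambda>g. F g * B) A $$ (i, j)"
    using ij by (simp add: mat_sum_def)
qed (use B in \<open>auto simp: mat_sum_def\<close>)

lemma mat_trace_sum:
  assumes "\<And>g. g \<in> A \<Longrightarrow> F g \<in> carrier_mat d d"
  shows "mat_trace (mat_sum d d F A) = (\<Sum>g\<in>A. mat_trace (F g))"
proof -
  have "mat_trace (mat_sum d d F A) = (\<Sum>i<d. \<Sum>g\<in>A. F g $$ (i, i))"
    by (simp add: mat_trace_def mat_sum_def)
  also have "\<dots> = (\<Sum>g\<in>A. \<Sum>i<d. F g $$ (i, i))" by (rule sum.swap)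
  also have "\<dots> = (\<Sum>g\<in>A. mat_trace (F g))"
    using assms by (intro sum.cong) (auto simp: mat_trace_def)
  finally show ?thesis .
qed

lemma mat_trace_smult [simp]: "mat_trace (a \<cdot>\<^sub>m A) = a * mat_trace A" if "A \<in> carrier_mat d d"
  using that by (auto simp: mat_trace_def sum_distrib_left)

section \<open>Subspaces in coordinates\<close>

text \<open>The columns of \<open>P\<close> form a basis of \<open>U\<close> and \<open>Q\<close>
  gives coordinates, so that P Q projects onto \<open>U\<close>. Such a pair is a frame inside
  \<open>U\<close> that cannot be enlarged: a vector u of \<open>U\<close> with P Q u different from
  u would supply one more column. The number of columns is at most \<open>d\<close>, since
  \<open>P\<close> has a left inverse.\<close>

lemma subspace_frame:
  assumes U: "is_subspace_vec d U"
  obtains e P Q where "e \<le> d" "P \<in> carrier_mat d e" "Q \<in> carrier_mat e d" "Q * P = 1\<^sub>m e"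
    "\<And>v. v \<in> carrier_vec e \<Longrightarrow> P *\<^sub>v v \<in> U" "\<And>u. u \<in> U \<Longrightarrow> P *\<^sub>v (Q *\<^sub>v u) = u"
proof -
  define ok where "ok e \<longleftrightarrow> (\<exists>P Q. P \<in> carrier_mat d e \<and> Q \<in> carrier_mat e d \<and> Q * P = 1\<^sub>m e \<and>
    (\<forall>v \<in> carrier_vec e. P *\<^sub>v v \<in> U))" for e
  have "ok 0" unfolding ok_def
  proof (rule exI[of _ "0\<^sub>m d 0"], rule exI[of _ "0\<^sub>m 0 d"], intro conjI ballI)
    show "0\<^sub>m d 0 *\<^sub>v v \<in> U" if "v \<in> carrier_vec 0" for v
    proof -
      have "0\<^sub>m d 0 *\<^sub>v v = (0\<^sub>v d :: complex vec)" using that by (intro eq_vecI) (auto simp: scalar_prod_def)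
      then show ?thesis using U by (simp add: is_subspace_vec_def)
    qed
    show "0\<^sub>m 0 d * 0\<^sub>m d 0 = (1\<^sub>m 0 :: complex mat)" by (rule eq_matI) simp_all
  qed (rule zero_carrier_mat)+
  moreover have bound: "e \<le> d" if oke: "ok e" for e
  proof (rule ccontr)
    assume "\<not> e \<le> d"
    obtain P Q :: "complex mat" where PQ: "P \<in> carrier_mat d e" "Q \<in> carrier_mat e d" "Q * P = 1\<^sub>m e"
      using oke unfolding ok_def by blast
    obtain f where f: "\<exists>t\<in>{0..<e}. f t \<noteq> 0" "\<forall>i\<in>{0..<d}. (\<Sum>t\<in>{0..<e}. P $$ (i, t) * f t) = 0"
      using underdetermined_system[of "{0..<d}" "{0..<e}" "\<lambda>i t. P $$ (i, t)"] \<open>\<not> e \<le> d\<close> by auto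
    have "P *\<^sub>v vec e f = 0\<^sub>v d"
      using f(2) PQ by (intro eq_vecI) (auto simp: scalar_prod_def)
    then have "(Q * P) *\<^sub>v vec e f = 0\<^sub>v e"
      using PQ assoc_mult_mat_vec[OF PQ(2,1), of "vec e f"] mult_mat_zero_vec[OF PQ(2)] by simp
    then have "vec e f = 0\<^sub>v e" using PQ by simp
    then show False using f(1) by (metis atLeastLessThan_iff index_vec index_zero_vec(1))
  qed
  moreover have "ok e" if "ok 0" "\<And>e. ok e \<Longrightarrow> ok (Suc e)" for e
    using that by (induction e) auto
  ultimately obtain e where e: "ok e" "\<not> ok (Suc e)"
    using Suc_n_not_le_n by blast
  then obtain P Q :: "complex mat" where PQ: "P \<in> carrier_mat d e" "Q \<in> carrier_mat e d" "Q * P = 1\<^sub>m e"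
    "\<forall>v \<in> carrier_vec e. P *\<^sub>v v \<in> U" unfolding ok_def by blast
  have "P *\<^sub>v (Q *\<^sub>v u) = u" if u: "u \<in> U" for u
  proof (rule ccontr)
    assume neq: "P *\<^sub>v (Q *\<^sub>v u) \<noteq> u"
    have ud: "u \<in> carrier_vec d" using u U by (auto simp: is_subspace_vec_def)
    have Qu: "Q *\<^sub>v u \<in> carrier_vec e" using PQ ud by auto
    \<comment> \<open>The component of \<open>u\<close> that the projection P Q misses. It lies in
      the kernel of \<open>Q\<close> and becomes the new column.\<close>
    define x where "x = u + (- 1) \<cdot>\<^sub>v (P *\<^sub>v (Q *\<^sub>v u))"
    have xU: "x \<in> U" using u U PQ Qu unfolding x_def is_subspace_vec_def by blast
    have xd: "x \<in> carrier_vec d" using xU U by (auto simp: is_subspace_vec_def)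
    have Qx: "Q *\<^sub>v x = 0\<^sub>v e"
    proof -
      have "Q *\<^sub>v x = Q *\<^sub>v u + (- 1) \<cdot>\<^sub>v (Q *\<^sub>v (P *\<^sub>v (Q *\<^sub>v u)))"
        unfolding x_def using PQ Qu ud
        by (simp add: mult_add_distrib_mat_vec[of Q e d] mult_mat_vec[of Q e d])
      also have "Q *\<^sub>v (P *\<^sub>v (Q *\<^sub>v u)) = Q *\<^sub>v u"
        using assoc_mult_mat_vec[OF PQ(2,1) Qu] PQ(3) Qu by simp
      also have "Q *\<^sub>v u + (- 1) \<cdot>\<^sub>v (Q *\<^sub>v u) = 0\<^sub>v e" by (rule vec_add_neg[OF Qu])
      finally show ?thesis .
    qed
    obtain p where p: "p < d" "x $ p \<noteq> 0"
    proof (rule ccontr)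
      assume "\<not> thesis"
      then have "\<forall>p<d. x $ p = 0" using that by blast
      then have "P *\<^sub>v (Q *\<^sub>v u) = u"
        using ud PQ by (intro eq_vecI) (auto simp: x_def)
      then show False using neq by simp
    qed
    define PQm where "PQm = P * Q"
    \<comment> \<open>Row \<open>p\<close> of 1 - P Q, divided by \<open>x $ p\<close>. As 1 - P Q
      annihilates the columns of \<open>P\<close> and fixes \<open>x\<close>, this is the new row of
      the left inverse.\<close>
    define q where "q = vec d (\<lambda>j. ((if j = p then 1 else 0) - PQm $$ (p, j)) / x $ p)"
    have PQm: "PQm \<in> carrier_mat d d" using PQ by (simp add: PQm_def)
    have q_dot: "q \<bullet> y = (y $ p - (PQm *\<^sub>v y) $ p) / x $ p" if "y \<in> carrier_vec d" for y
    proof -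
      have "q \<bullet> y = (\<Sum>j\<in>{0..<d}. ((if j = p then y $ j else 0) - PQm $$ (p, j) * y $ j) / x $ p)"
        using that by (auto simp: scalar_prod_def q_def algebra_simps intro!: sum.cong)
      also have "\<dots> = (y $ p - (PQm *\<^sub>v y) $ p) / x $ p"
        using that PQm p
        by (simp add: sum_divide_distrib[symmetric] sum_subtractf scalar_prod_def)
      finally show ?thesis .
    qed
    have qx: "q \<bullet> x = 1"
    proof -
      have "PQm *\<^sub>v x = 0\<^sub>v d"
        unfolding PQm_def using assoc_mult_mat_vec[OF PQ(1,2) xd] Qx mult_mat_zero_vec[OF PQ(1)] by simp
      then show ?thesis using q_dot[OF xd] p by simp
    qed
    have qP: "q \<bullet> col P j = 0" if "j < e" for j
    proof -
      have "PQm * P = P"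
        unfolding PQm_def using assoc_mult_mat[OF PQ(1,2,1)] PQ by simp
      then have "PQm *\<^sub>v col P j = col P j"
        using that PQ PQm by (metis carrier_matD(2) col_mult2)
      moreover have "col P j \<in> carrier_vec d"
        using col_dim[of P j] carrier_matD(1)[OF PQ(1)] by simp
      ultimately show ?thesis using q_dot[of "col P j"] by simp
    qed
    define P' where "P' = mat d (Suc e) (\<lambda>(i, j). if j < e then P $$ (i, j) else x $ i)"
    define Q' where "Q' = mat (Suc e) d (\<lambda>(i, j). if i < e then Q $$ (i, j) else q $ j)"
    have colP: "col P' j = (if j < e then col P j else x)" if "j < Suc e" for j
      using that PQ xd by (intro eq_vecI) (auto simp: P'_def)
    have rowQ: "row Q' i = (if i < e then row Q i else q)" if "i < Suc e" for i
      using that PQ by (intro eq_vecI) (auto simp: Q'_def q_def)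
    have "Q' * P' = 1\<^sub>m (Suc e)"
    proof (rule eq_matI)
      fix i j assume "i < dim_row (1\<^sub>m (Suc e) :: complex mat)" "j < dim_col (1\<^sub>m (Suc e) :: complex mat)"
      then have ij: "i < Suc e" "j < Suc e" by auto
      then have *: "(Q' * P') $$ (i, j) = row Q' i \<bullet> col P' j" by (simp add: P'_def Q'_def)
      have a: "row Q i \<bullet> col P j = (1\<^sub>m e :: complex mat) $$ (i, j)" if "i < e" "j < e"
        using PQ(1,2) that unfolding PQ(3)[symmetric] by simp
      have b: "row Q i \<bullet> x = 0" if "i < e"
        using arg_cong[OF Qx, of "\<lambda>v. v $ i"] PQ that by simp
      show "(Q' * P') $$ (i, j) = (1\<^sub>m (Suc e) :: complex mat) $$ (i, j)"
        unfolding * colP[OF ij(2)] rowQ[OF ij(1)] using ij a b qx qP by auto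
    qed (auto simp: P'_def Q'_def)
    moreover have "P' *\<^sub>v v \<in> U" if v: "v \<in> carrier_vec (Suc e)" for v
    proof -
      have "P' *\<^sub>v v = P *\<^sub>v vec e (($) v) + v $ e \<cdot>\<^sub>v x"
        using v PQ xd by (intro eq_vecI) (auto simp: P'_def scalar_prod_def)
      moreover have "P *\<^sub>v vec e (($) v) \<in> U" using PQ by auto
      ultimately show ?thesis using xU U by (simp add: is_subspace_vec_def)
    qed
    ultimately have "ok (Suc e)" unfolding ok_def
      by (intro exI[of _ P'] exI[of _ Q']) (auto simp: P'_def Q'_def)
    then show False using e by simp
  qed
  then show ?thesis using that[OF bound[OF e(1)] PQ(1-3)] PQ(4) by blast
qed

section \<open>Schur's lemma and orthogonality of characters\<close>

lemma is_repD:
  assumes "is_rep G d \<rho>"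
  shows "g \<in> carrier G \<Longrightarrow> \<rho> g \<in> carrier_mat d d"
    and "\<rho> \<one>\<^bsub>G\<^esub> = 1\<^sub>m d"
    and "g \<in> carrier G \<Longrightarrow> h \<in> carrier G \<Longrightarrow> \<rho> (g \<otimes>\<^bsub>G\<^esub> h) = \<rho> g * \<rho> h"
  using assms by (auto simp: is_rep_def)

lemma irreducible_repD:
  assumes "irreducible_rep G d \<rho>"
  shows "is_rep G d \<rho>" "d > 0"
    "is_subspace_vec d W \<Longrightarrow> (\<And>g w. g \<in> carrier G \<Longrightarrow> w \<in> W \<Longrightarrow> \<rho> g *\<^sub>v w \<in> W)
      \<Longrightarrow> W = {0\<^sub>v d} \<or> W = carrier_vec d"
  using assms by (auto simp: irreducible_rep_def)

lemma kernel_subspace: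
  "T \<in> carrier_mat d e \<Longrightarrow> is_subspace_vec e {v \<in> carrier_vec e. T *\<^sub>v v = 0\<^sub>v d}"
  by (auto simp: is_subspace_vec_def mult_add_distrib_mat_vec[of T d e] mult_mat_vec[of T d e])

lemma range_subspace:
  assumes T: "T \<in> carrier_mat d e"
  shows "is_subspace_vec d ((*\<^sub>v) T ` carrier_vec e)"
  unfolding is_subspace_vec_def
proof (intro conjI ballI allI)
  show "0\<^sub>v d \<in> (*\<^sub>v) T ` carrier_vec e"
    using T by (intro image_eqI[of _ _ "0\<^sub>v e"]) auto
  show "v + w \<in> (*\<^sub>v) T ` carrier_vec e"
    if vw: "v \<in> (*\<^sub>v) T ` carrier_vec e" "w \<in> (*\<^sub>v) T ` carrier_vec e" for v w
  proof -
    obtain a b where "v = T *\<^sub>v a" "a \<in> carrier_vec e" "w = T *\<^sub>v b" "b \<in> carrier_vec e"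
      using vw by blast
    then show ?thesis using T by (intro image_eqI[of _ _ "a + b"]) (auto simp: mult_add_distrib_mat_vec)
  qed
  show "c \<cdot>\<^sub>v v \<in> (*\<^sub>v) T ` carrier_vec e" if v: "v \<in> (*\<^sub>v) T ` carrier_vec e" for c v
  proof -
    obtain a where "v = T *\<^sub>v a" "a \<in> carrier_vec e" using v by blast
    then show ?thesis using T by (intro image_eqI[of _ _ "c \<cdot>\<^sub>v a"]) (auto simp: mult_mat_vec)
  qed
qed (use T in auto)

definition elem_mat :: "nat \<Rightarrow> nat \<Rightarrow> nat \<Rightarrow> nat \<Rightarrow> complex mat" where
  "elem_mat d e a b = mat d e (\<lambda>(x, y). if x = a \<and> y = b then 1 else 0)"

lemma elem_mat_carrier [simp]: "elem_mat d e a b \<in> carrier_mat d e"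
  by (simp add: elem_mat_def)

text \<open>With i = a and j = b, summation over both indices yields the product of the traces of
  \<open>A\<close> and \<open>B\<close>. This converts character sums into sums over matrix
  units.\<close>

lemma elem_mat_sandwich:
  assumes "A \<in> carrier_mat d d" "B \<in> carrier_mat e e" "a < d" "b < e" "i < d" "j < e"
  shows "(A * elem_mat d e a b * B) $$ (i, j) = A $$ (i, a) * B $$ (b, j)"
proof -
  have "(A * elem_mat d e a b) $$ (i, y) = (if y = b then A $$ (i, a) else 0)" if "y < e" for y
    using assms that
    by (cases "y = b") (auto simp: elem_mat_def scalar_prod_def if_distrib[of "\<lambda>x. _ * x"] cong: if_cong)
  then have "(A * elem_mat d e a b * B) $$ (i, j) = (\<Sum>y\<in>{0..<e}. (if y = b then A $$ (i, a) else 0) * B $$ (y, j))"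
    using assms by (auto simp: scalar_prod_def elem_mat_def intro!: sum.cong)
  then show ?thesis using assms by (simp add: if_distrib[of "\<lambda>x. x * _"] cong: if_cong)
qed

context group
begin

text \<open>The kernel of \<open>T\<close> is invariant under \<open>\<sigma>\<close> and contains
  the nonzero vector \<open>v\<close>, hence is everything.\<close>

lemma intertwiner_kernel:
  assumes \<sigma>: "irreducible_rep G e \<sigma>" and \<rho>: "is_rep G d \<rho>"
    and T: "T \<in> carrier_mat d e" "\<And>g. g \<in> carrier G \<Longrightarrow> \<rho> g * T = T * \<sigma> g"
    and v: "v \<in> carrier_vec e" "v \<noteq> 0\<^sub>v e" "T *\<^sub>v v = 0\<^sub>v d"
  shows "T = 0\<^sub>m d e"
proof -
  define K where "K = {v \<in> carrier_vec e. T *\<^sub>v v = 0\<^sub>v d}"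
  have "K = {0\<^sub>v e} \<or> K = carrier_vec e"
  proof (rule irreducible_repD(3)[OF \<sigma>])
    show "is_subspace_vec e K" unfolding K_def by (rule kernel_subspace[OF T(1)])
    fix g w assume g: "g \<in> carrier G" and w: "w \<in> K"
    note S = is_repD(1)[OF irreducible_repD(1)[OF \<sigma>] g]
    note R = is_repD(1)[OF \<rho> g]
    have "T *\<^sub>v (\<sigma> g *\<^sub>v w) = \<rho> g *\<^sub>v (T *\<^sub>v w)"
      using assoc_mult_mat_vec[OF T(1) S, of w] assoc_mult_mat_vec[OF R T(1), of w] T(2)[OF g] w
      by (auto simp: K_def)
    also have "\<dots> = 0\<^sub>v d" using w R by (auto simp: K_def)
    finally show "\<sigma> g *\<^sub>v w \<in> K" using S w by (auto simp: K_def)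
  qed
  then have "K = carrier_vec e" using v by (auto simp: K_def)
  then show ?thesis using T(1) by (intro mat_eq_zero_on_vecI) (auto simp: K_def)
qed

text \<open>Irreducibility of \<open>\<sigma>\<close> makes \<open>T\<close> injective and that of
  \<open>\<rho>\<close> makes it surjective, so \<open>T\<close> conjugates one representation into
  the other. A right inverse \<open>Y\<close> is assembled from preimages of the unit
  vectors.\<close>

lemma schur_traces_eq:
  assumes \<rho>: "irreducible_rep G d \<rho>" and \<sigma>: "irreducible_rep G e \<sigma>"
    and T: "T \<in> carrier_mat d e" "\<And>g. g \<in> carrier G \<Longrightarrow> \<rho> g * T = T * \<sigma> g" "T \<noteq> 0\<^sub>m d e"
    and g: "g \<in> carrier G"
  shows "mat_trace (\<rho> g) = mat_trace (\<sigma> g)"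
proof -
  note rep\<rho> = irreducible_repD(1)[OF \<rho>] and rep\<sigma> = irreducible_repD(1)[OF \<sigma>]
  have ker: "v = 0\<^sub>v e" if "v \<in> carrier_vec e" "T *\<^sub>v v = 0\<^sub>v d" for v
    using intertwiner_kernel[OF \<sigma> rep\<rho> T(1,2) that(1) _ that(2)] T(3) by blast
  define R where "R = (*\<^sub>v) T ` carrier_vec e"
  have "R = {0\<^sub>v d} \<or> R = carrier_vec d"
  proof (rule irreducible_repD(3)[OF \<rho>])
    show "is_subspace_vec d R" unfolding R_def by (rule range_subspace[OF T(1)])
    fix h w assume h: "h \<in> carrier G" and w: "w \<in> R"
    then obtain v where v: "v \<in> carrier_vec e" "w = T *\<^sub>v v" by (auto simp: R_def)
    note S = is_repD(1)[OF rep\<sigma> h]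
    note R = is_repD(1)[OF rep\<rho> h]
    have "\<rho> h *\<^sub>v w = T *\<^sub>v (\<sigma> h *\<^sub>v v)"
      using assoc_mult_mat_vec[OF T(1) S, of v] assoc_mult_mat_vec[OF R T(1), of v] T(2)[OF h] v
      by auto
    then show "\<rho> h *\<^sub>v w \<in> R" using v S by (auto simp: R_def)
  qed
  moreover have "R \<noteq> {0\<^sub>v d}"
  proof
    assume "R = {0\<^sub>v d}"
    then have "T = 0\<^sub>m d e" using T(1) by (intro mat_eq_zero_on_vecI) (auto simp: R_def)
    then show False using T(3) by simp
  qed
  ultimately have "\<forall>j. \<exists>v. j < d \<longrightarrow> v \<in> carrier_vec e \<and> T *\<^sub>v v = unit_vec d j"
    unfolding R_def by (metis imageE unit_vec_carrier)
  then obtain y where y: "\<And>j. j < d \<Longrightarrow> y j \<in> carrier_vec e" "\<And>j. j < d \<Longrightarrow> T *\<^sub>v y j = unit_vec d j"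
    by metis
  define Y where "Y = mat e d (\<lambda>(i, j). y j $ i)"
  have Y: "Y \<in> carrier_mat e d" by (simp add: Y_def)
  have colY: "col Y j = y j" if "j < d" for j
    using y(1)[OF that] that by (intro eq_vecI) (auto simp: Y_def)
  have XY: "T * Y = 1\<^sub>m d"
  proof (rule mat_col_eqI)
    fix j assume "j < dim_col (1\<^sub>m d :: complex mat)"
    then have j: "j < d" by simp
    have "col (T * Y) j = T *\<^sub>v col Y j" using col_mult2[OF T(1) Y j] .
    then show "col (T * Y) j = col (1\<^sub>m d) j" using colY[OF j] y(2)[OF j] j by simp
  qed (use T(1) Y in auto)
  \<comment> \<open>As \<open>d = e\<close> is not known beforehand, the second inverse law is
    derived from injectivity: \<open>T\<close> maps Y T v and v to the same vector.\<close>
  have YX: "Y * T = 1\<^sub>m e"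
  proof (rule mat_eq_on_vecI[of _ e e])
    fix v :: "complex vec" assume v: "v \<in> carrier_vec e"
    have Xv: "T *\<^sub>v v \<in> carrier_vec d" using T(1) v by auto
    have YXv: "(Y * T) *\<^sub>v v \<in> carrier_vec e" using T(1) Y v by auto
    have "T *\<^sub>v ((Y * T) *\<^sub>v v) = T *\<^sub>v v"
      using assoc_mult_mat_vec[OF Y T(1) v] assoc_mult_mat_vec[OF T(1) Y Xv] XY Xv by simp
    then have "T *\<^sub>v ((Y * T) *\<^sub>v v + (- 1) \<cdot>\<^sub>v v) = 0\<^sub>v d"
      using T(1) YXv v vec_add_neg[OF Xv]
      by (simp add: mult_add_distrib_mat_vec[of T d e] mult_mat_vec[of T d e])
    then have z: "(Y * T) *\<^sub>v v + (- 1) \<cdot>\<^sub>v v = 0\<^sub>v e" using YXv v by (intro ker) auto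
    have "((Y * T) *\<^sub>v v) $ i = v $ i" if "i < e" for i
      using arg_cong[OF z, of "\<lambda>v. v $ i"] that v YXv Y T(1) by simp
    then show "(Y * T) *\<^sub>v v = 1\<^sub>m e *\<^sub>v v" using v YXv T(1) Y by (intro eq_vecI) auto
  qed (use T Y in auto)
  note R = is_repD(1)[OF rep\<rho> g] and S = is_repD(1)[OF rep\<sigma> g]
  have "mat_trace (\<rho> g) = mat_trace (\<rho> g * T * Y)"
    using assoc_mult_mat[OF R T(1) Y] XY R by simp
  also have "\<rho> g * T * Y = T * (\<sigma> g * Y)" unfolding T(2)[OF g] by (rule assoc_mult_mat[OF T(1) S Y])
  also have "mat_trace \<dots> = mat_trace (\<sigma> g * Y * T)"
    by (rule mat_trace_comm[OF T(1)]) (use S Y in auto)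
  also have "\<dots> = mat_trace (\<sigma> g)" using assoc_mult_mat[OF S Y T(1)] YX S by simp
  finally show ?thesis .
qed

text \<open>Over the complex numbers \<open>T\<close> has an eigenvalue k, and T - k 1 is an
  intertwiner with nonzero kernel.\<close>

lemma schur_scalar:
  assumes \<rho>: "irreducible_rep G d \<rho>"
    and T: "T \<in> carrier_mat d d" "\<And>g. g \<in> carrier G \<Longrightarrow> \<rho> g * T = T * \<rho> g"
  obtains k where "T = k \<cdot>\<^sub>m 1\<^sub>m d"
proof -
  note rep = irreducible_repD(1)[OF \<rho>]
  obtain k where "eigenvalue T k"
    using spectrum_non_empty[OF T(1) irreducible_repD(2)[OF \<rho>]] by (auto simp: spectrum_def)
  then obtain v where v: "v \<in> carrier_vec d" "v \<noteq> 0\<^sub>v d" "T *\<^sub>v v = k \<cdot>\<^sub>v v"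
    using T(1) by (auto simp: eigenvalue_def eigenvector_def)
  define Y where "Y = T + (- k) \<cdot>\<^sub>m 1\<^sub>m d"
  have Y: "Y \<in> carrier_mat d d" using T(1) by (simp add: Y_def)
  have "Y = 0\<^sub>m d d"
  proof (rule intertwiner_kernel[OF \<rho> rep Y _ v(1,2)])
    fix g assume g: "g \<in> carrier G"
    note R = is_repD(1)[OF rep g]
    show "\<rho> g * Y = Y * \<rho> g"
      unfolding Y_def using R T
      by (simp add: mult_add_distrib_mat[of _ d d] add_mult_distrib_mat[of _ d d] g
          mult_smult_distrib[OF R one_carrier_mat] mult_smult_assoc_mat[OF one_carrier_mat R])
  next
    have "Y *\<^sub>v v = T *\<^sub>v v + ((- k) \<cdot>\<^sub>m 1\<^sub>m d) *\<^sub>v v"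
      unfolding Y_def using T(1) v(1) by (intro add_mult_distrib_mat_vec[of _ d d]) auto
    also have "((- k) \<cdot>\<^sub>m 1\<^sub>m d) *\<^sub>v v = (- k) \<cdot>\<^sub>v v"
      by (rule smult_one_mult_vec[OF v(1)])
    finally show "Y *\<^sub>v v = 0\<^sub>v d" using v by (auto intro!: eq_vecI)
  qed
  have "T = k \<cdot>\<^sub>m 1\<^sub>m d"
  proof (rule eq_matI)
    fix i j assume "i < dim_row (k \<cdot>\<^sub>m 1\<^sub>m d)" "j < dim_col (k \<cdot>\<^sub>m 1\<^sub>m d)"
    then show "T $$ (i, j) = (k \<cdot>\<^sub>m 1\<^sub>m d) $$ (i, j)"
      using arg_cong[OF \<open>Y = 0\<^sub>m d d\<close>, of "\<lambda>A. A $$ (i, j)"] T(1) by (simp add: Y_def)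
  qed (use T in auto)
  then show ?thesis using that by blast
qed

section \<open>Values of characters of a finite group\<close>

lemma rep_pow:
  assumes "is_rep G d \<rho>" "g \<in> carrier G"
  shows "\<rho> (g [^] (k::nat)) = \<rho> g ^\<^sub>m k"
  using is_repD[OF assms(1)] assms(2) by (induction k) auto

lemma rep_inv_mult:
  assumes "is_rep G d \<rho>" "g \<in> carrier G"
  shows "\<rho> (inv g) * \<rho> g = 1\<^sub>m d"
  using is_repD[OF assms(1)] assms(2) by (metis inv_closed l_inv)

text \<open>The eigenvalues of \<rho> g are roots of unity. Their conjugates are their inverses, and
  their real parts are at most 1, with equality only for the eigenvalue 1.\<close>

lemma rep_trace_properties:
  assumes fin: "finite (carrier G)" and \<rho>: "is_rep G d \<rho>" and g: "g \<in> carrier G"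
  shows "mat_trace (\<rho> (inv g)) = cnj (mat_trace (\<rho> g))"
    and "Re (mat_trace (\<rho> g)) \<le> real d"
    and "Re (mat_trace (\<rho> g)) = real d \<Longrightarrow> \<rho> g = 1\<^sub>m d"
proof -
  note R = is_repD(1)[OF \<rho> g]
  obtain ev where ev: "\<And>k. mat_trace (\<rho> g ^\<^sub>m k) = (\<Sum>i<d. ev i ^ k)"
    "\<And>i. i < d \<Longrightarrow> eigenvalue (\<rho> g) (ev i)"
    "\<And>N. N > 0 \<Longrightarrow> \<rho> g ^\<^sub>m N = 1\<^sub>m d \<Longrightarrow> (\<And>i. i < d \<Longrightarrow> ev i = 1) \<Longrightarrow> \<rho> g = 1\<^sub>m d"
    using complex_mat_spectrum[OF R] by blast
  define N where "N = Coset.order G"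
  have N: "N > 0" using fin by (auto simp: N_def order_gt_0_iff_finite)
  have "g [^] N = \<one>" using g by (simp add: N_def pow_order_eq_1)
  then have RN: "\<rho> g ^\<^sub>m N = 1\<^sub>m d" using rep_pow[OF \<rho> g, of N] is_repD(2)[OF \<rho>] by simp
  have evN: "ev i ^ N = 1" if i: "i < d" for i
  proof -
    obtain v where v: "eigenvector (\<rho> g) v (ev i)" using ev(2)[OF i] by (auto simp: eigenvalue_def)
    then have vd: "v \<in> carrier_vec d" "v \<noteq> 0\<^sub>v d" using R by (auto simp: eigenvector_def)
    have "v = ev i ^ N \<cdot>\<^sub>v v" using eigenvector_pow[OF R v, of N] RN vd by simp
    moreover obtain j where j: "j < d" "v $ j \<noteq> 0" using vd by (metis carrier_vecD eq_vecI index_zero_vec)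
    ultimately have "v $ j = ev i ^ N * v $ j" using vd by (metis carrier_vecD index_smult_vec(1))
    then show ?thesis using j by simp
  qed
  have norm: "cmod (ev i) = 1" if "i < d" for i
  proof -
    have "cmod (ev i) ^ N = 1" using evN[OF that] by (metis norm_one norm_power)
    then show ?thesis using N by (metis norm_ge_zero power_eq_1_iff real_norm_def abs_of_nonneg less_not_refl)
  qed
  have tr: "mat_trace (\<rho> g) = (\<Sum>i<d. ev i)" using ev(1)[of 1] R by simp
  \<comment> \<open>Writing the inverse as a power with natural exponent makes its trace a power sum
    of the same eigenvalues.\<close>
  have "inv g = g [^] (N - 1)"
  proof (rule inv_equality)
    show "g [^] (N - 1) \<otimes> g = \<one>"
      using N \<open>g [^] N = \<one>\<close> g by (metis Suc_diff_1 nat_pow_Suc)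
  qed (use g in auto)
  then have "mat_trace (\<rho> (inv g)) = (\<Sum>i<d. ev i ^ (N - 1))"
    using rep_pow[OF \<rho> g] ev(1) by simp
  also have "\<dots> = (\<Sum>i<d. cnj (ev i))"
  proof (rule sum.cong)
    fix i assume "i \<in> {..<d}"
    then have i: "i < d" by simp
    have 1: "ev i * cnj (ev i) = 1" using complex_norm_square[of "ev i"] norm[OF i] by simp
    have 2: "ev i ^ (N - 1) * ev i = 1" using evN[OF i] N by (metis Suc_diff_1 power_Suc2)
    show "ev i ^ (N - 1) = cnj (ev i)" using 1 2 by (metis mult.assoc mult.commute mult_1)
  qed simp
  finally show "mat_trace (\<rho> (inv g)) = cnj (mat_trace (\<rho> g))" by (simp add: tr)
  have Re_le: "Re (ev i) \<le> 1" if "i < d" for i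
    using complex_Re_le_cmod[of "ev i"] norm[OF that] by simp
  show "Re (mat_trace (\<rho> g)) \<le> real d"
    using sum_mono[of "{..<d}" "\<lambda>i. Re (ev i)" "\<lambda>_. 1"] Re_le by (simp add: tr)
  assume "Re (mat_trace (\<rho> g)) = real d"
  then have "(\<Sum>i<d. 1 - Re (ev i)) = 0" by (simp add: tr sum_subtractf)
  then have "\<forall>i\<in>{..<d}. 1 - Re (ev i) = 0"
    using Re_le by (subst (asm) sum_nonneg_eq_0_iff) auto
  then have "ev i = 1" if "i < d" for i
    using that norm[OF that] by (simp add: complex_eq_iff cmod_def)
  then show "\<rho> g = 1\<^sub>m d" using ev(3)[OF N RN] by blast
qed

section \<open>Averaging and orthogonality relations\<close>

definition average :: "nat \<Rightarrow> nat \<Rightarrow> ('a \<Rightarrow> complex mat) \<Rightarrow> ('a \<Rightarrow> complex mat) \<Rightarrow> complex mat \<Rightarrow> complex mat" where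
  "average d e \<rho> \<sigma> T = mat_sum d e (\<lambda>g. \<rho> g * T * \<sigma> (inv g)) (carrier G)"

lemma average_carrier [simp]: "average d e \<rho> \<sigma> T \<in> carrier_mat d e"
  by (simp add: average_def)

lemma average_intertwines:
  assumes \<rho>: "is_rep G d \<rho>" and \<sigma>: "is_rep G e \<sigma>" and T: "T \<in> carrier_mat d e" and h: "h \<in> carrier G"
  shows "\<rho> h * average d e \<rho> \<sigma> T = average d e \<rho> \<sigma> T * \<sigma> h"
proof -
  note R = is_repD[OF \<rho>] and S = is_repD[OF \<sigma>]
  have c: "\<rho> g * T * \<sigma> (inv g) \<in> carrier_mat d e" if "g \<in> carrier G" for g
    using R(1)[OF that] S(1)[OF inv_closed[OF that]] T by (meson mult_carrier_mat)
  have "\<rho> h * average d e \<rho> \<sigma> T = mat_sum d e (\<lambda>g. \<rho> h * (\<rho> g * T * \<sigma> (inv g))) (carrier G)"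
    unfolding average_def using R(1)[OF h] c by (rule mult_mat_sum)
  \<comment> \<open>The summand is rewritten as a function of h g, using that inv g equals inv (h g)
    times h, so that translation by \<open>h\<close> can be removed by reindexing.\<close>
  also have "\<dots> = mat_sum d e (\<lambda>g. (\<lambda>g. \<rho> g * T * \<sigma> (inv g \<otimes> h)) (h \<otimes> g)) (carrier G)"
  proof (rule mat_sum_cong)
    fix g assume g: "g \<in> carrier G"
    have c: "\<rho> h \<in> carrier_mat d d" "\<rho> g \<in> carrier_mat d d" "\<sigma> (inv g) \<in> carrier_mat e e"
      using R S g h by auto
    have "inv (h \<otimes> g) \<otimes> h = inv g" using g h by (simp add: inv_mult_group m_assoc)
    then show "\<rho> h * (\<rho> g * T * \<sigma> (inv g)) = (\<lambda>g. \<rho> g * T * \<sigma> (inv g \<otimes> h)) (h \<otimes> g)"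
      using R(3)[OF h g] c T by (simp add: assoc_mult_mat[of _ d d] assoc_mult_mat[of _ d d _ e])
  qed
  also have "\<dots> = mat_sum d e (\<lambda>g. \<rho> g * T * \<sigma> (inv g \<otimes> h)) (carrier G)"
  proof (rule mat_sum_reindex)
    show "bij_betw ((\<otimes>) h) (carrier G) (carrier G)"
      using h by (intro bij_betwI[of _ _ _ "(\<otimes>) (inv h)"]) (auto simp: m_assoc[symmetric])
  qed
  also have "\<dots> = mat_sum d e (\<lambda>g. \<rho> g * T * \<sigma> (inv g) * \<sigma> h) (carrier G)"
  proof (rule mat_sum_cong)
    fix g assume g: "g \<in> carrier G"
    have "\<sigma> (inv g \<otimes> h) = \<sigma> (inv g) * \<sigma> h" using S(3) g h by simp
    moreover have "\<rho> g * T \<in> carrier_mat d e" "\<sigma> (inv g) \<in> carrier_mat e e" "\<sigma> h \<in> carrier_mat e e"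
      using mult_carrier_mat[OF R(1)[OF g] T] S g h by auto
    ultimately show "\<rho> g * T * \<sigma> (inv g \<otimes> h) = \<rho> g * T * \<sigma> (inv g) * \<sigma> h"
      by (simp add: assoc_mult_mat[of _ d e])
  qed
  also have "\<dots> = average d e \<rho> \<sigma> T * \<sigma> h"
    unfolding average_def using S(1)[OF h] c by (rule mat_sum_mult[symmetric])
  finally show ?thesis .
qed

lemma sum_trace_average:
  assumes \<rho>: "is_rep G d \<rho>" and \<sigma>: "is_rep G e \<sigma>"
  shows "(\<Sum>g\<in>carrier G. mat_trace (\<rho> g) * mat_trace (\<sigma> (inv g))) =
    (\<Sum>i<d. \<Sum>j<e. average d e \<rho> \<sigma> (elem_mat d e i j) $$ (i, j))"
proof -
  have "(\<Sum>g\<in>carrier G. mat_trace (\<rho> g) * mat_trace (\<sigma> (inv g))) =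
    (\<Sum>g\<in>carrier G. \<Sum>i<d. \<Sum>j<e. (\<rho> g * elem_mat d e i j * \<sigma> (inv g)) $$ (i, j))"
  proof (rule sum.cong)
    fix g assume g: "g \<in> carrier G"
    have c: "\<rho> g \<in> carrier_mat d d" "\<sigma> (inv g) \<in> carrier_mat e e"
      using is_repD(1)[OF \<rho>] is_repD(1)[OF \<sigma>] g by auto
    then show "mat_trace (\<rho> g) * mat_trace (\<sigma> (inv g)) =
        (\<Sum>i<d. \<Sum>j<e. (\<rho> g * elem_mat d e i j * \<sigma> (inv g)) $$ (i, j))"
      by (simp add: elem_mat_sandwich mat_trace_def sum_product del: index_mult_mat(1))
  qed simp
  also have "\<dots> = (\<Sum>i<d. \<Sum>g\<in>carrier G. \<Sum>j<e. (\<rho> g * elem_mat d e i j * \<sigma> (inv g)) $$ (i, j))"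
    by (rule sum.swap)
  also have "\<dots> = (\<Sum>i<d. \<Sum>j<e. \<Sum>g\<in>carrier G. (\<rho> g * elem_mat d e i j * \<sigma> (inv g)) $$ (i, j))"
    by (intro sum.cong refl sum.swap)
  also have "\<dots> = (\<Sum>i<d. \<Sum>j<e. average d e \<rho> \<sigma> (elem_mat d e i j) $$ (i, j))"
    by (simp add: average_def mat_sum_def)
  finally show ?thesis .
qed

text \<open>Traces that differ at a single element exclude a nonzero intertwiner, so every average
  of a matrix unit vanishes.\<close>

lemma orthogonality_different:
  assumes \<rho>: "irreducible_rep G d \<rho>" and \<sigma>: "irreducible_rep G e \<sigma>"
    and diff: "g \<in> carrier G" "mat_trace (\<rho> g) \<noteq> mat_trace (\<sigma> g)"
  shows "(\<Sum>g\<in>carrier G. mat_trace (\<rho> g) * mat_trace (\<sigma> (inv g))) = 0"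
proof -
  note r = irreducible_repD(1)[OF \<rho>] irreducible_repD(1)[OF \<sigma>]
  have "average d e \<rho> \<sigma> (elem_mat d e i j) = 0\<^sub>m d e" for i j
    using schur_traces_eq[OF \<rho> \<sigma> average_carrier average_intertwines[OF r] _ diff(1)] diff(2)
    by (metis elem_mat_carrier)
  then show ?thesis unfolding sum_trace_average[OF r] by simp
qed

text \<open>The average of a matrix unit is a scalar matrix, and its trace determines the scalar:
  all summands are conjugates of the unit, so the trace is the group order times that of the
  unit.\<close>

lemma orthogonality_same:
  assumes \<rho>: "irreducible_rep G d \<rho>"
  shows "(\<Sum>g\<in>carrier G. mat_trace (\<rho> g) * mat_trace (\<rho> (inv g))) = of_nat (card (carrier G))"
proof -
  note r = irreducible_repD(1)[OF \<rho>]
  have d: "d > 0" using irreducible_repD(2)[OF \<rho>] .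
  have avg: "average d d \<rho> \<rho> (elem_mat d d i j) $$ (i, j) = (if i = j then of_nat (card (carrier G)) / of_nat d else 0)"
    if ij: "i < d" "j < d" for i j
  proof -
    let ?E = "elem_mat d d i j"
    obtain k where k: "average d d \<rho> \<rho> ?E = k \<cdot>\<^sub>m 1\<^sub>m d"
      using schur_scalar[OF \<rho> average_carrier average_intertwines[OF r r elem_mat_carrier]] by blast
    have trE: "mat_trace ?E = (if i = j then 1 else 0)"
      using ij by (auto simp: mat_trace_def elem_mat_def)
    have "k * of_nat d = mat_trace (average d d \<rho> \<rho> ?E)" unfolding k by (simp add: mat_trace_smult[OF one_carrier_mat])
    also have "\<dots> = (\<Sum>g\<in>carrier G. mat_trace (\<rho> g * ?E * \<rho> (inv g)))"
      unfolding average_def using is_repD(1)[OF r]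
      by (intro mat_trace_sum) (meson elem_mat_carrier inv_closed mult_carrier_mat)
    also have "\<dots> = (\<Sum>g\<in>carrier G. mat_trace ?E)"
    proof (rule sum.cong)
      fix g assume g: "g \<in> carrier G"
      have c: "\<rho> g \<in> carrier_mat d d" "\<rho> (inv g) \<in> carrier_mat d d"
        using is_repD(1)[OF r] g by auto
      have "mat_trace (\<rho> g * ?E * \<rho> (inv g)) = mat_trace (\<rho> (inv g) * (\<rho> g * ?E))"
        using c by (intro mat_trace_comm[of _ d d]) auto
      also have "\<rho> (inv g) * (\<rho> g * ?E) = ?E"
        using assoc_mult_mat[OF c(2,1) elem_mat_carrier] rep_inv_mult[OF r g]
          left_mult_one_mat[OF elem_mat_carrier] by metis
      finally show "mat_trace (\<rho> g * ?E * \<rho> (inv g)) = mat_trace ?E" .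
    qed simp
    finally have "k * of_nat d = of_nat (card (carrier G)) * mat_trace ?E" by simp
    then show ?thesis using d ij unfolding k trE by (auto simp: field_simps split: if_splits)
  qed
  have "(\<Sum>g\<in>carrier G. mat_trace (\<rho> g) * mat_trace (\<rho> (inv g))) =
    (\<Sum>i<d. \<Sum>j<d. (if i = j then of_nat (card (carrier G)) / of_nat d else 0))"
    unfolding sum_trace_average[OF r r] using avg by (intro sum.cong) auto
  also have "\<dots> = of_nat (card (carrier G))" using d by simp
  finally show ?thesis .
qed

section \<open>Completeness of the irreducible characters\<close>

text \<open>A nonzero invariant subspace of \<open>W\<close> of least dimension is irreducible.
  Subspaces are handled through frames as in \<open>subspace_frame\<close>, and \<rho> is the action
  of \<open>R\<close> in the coordinates of such a frame.\<close>

lemma irreducible_subrep: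
  assumes R: "is_rep G N R" and W: "is_subspace_vec N W" "W \<noteq> {0\<^sub>v N}"
    and inv: "\<And>g w. g \<in> carrier G \<Longrightarrow> w \<in> W \<Longrightarrow> R g *\<^sub>v w \<in> W"
  obtains d P Q \<rho> where "irreducible_rep G d \<rho>" "P \<in> carrier_mat N d" "Q \<in> carrier_mat d N"
    "Q * P = 1\<^sub>m d" "\<And>v. v \<in> carrier_vec d \<Longrightarrow> P *\<^sub>v v \<in> W"
    "\<And>g. g \<in> carrier G \<Longrightarrow> R g * P = P * \<rho> g"
proof -
  note Rc = is_repD(1)[OF R]
  \<comment> \<open>As P Q is a projection onto the range of \<open>P\<close>, the last clause
    states that this range is invariant.\<close>
  define ok where "ok d \<longleftrightarrow> d > 0 \<and> (\<exists>P Q. P \<in> carrier_mat N d \<and> Q \<in> carrier_mat d N \<and>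
    Q * P = 1\<^sub>m d \<and> (\<forall>v \<in> carrier_vec d. P *\<^sub>v v \<in> W) \<and>
    (\<forall>g \<in> carrier G. R g * P = P * (Q * (R g * P))))" for d
  have "\<exists>d. ok d"
  proof -
    obtain e P Q where frame: "P \<in> carrier_mat N e" "Q \<in> carrier_mat e N" "Q * P = 1\<^sub>m e"
      "\<And>v. v \<in> carrier_vec e \<Longrightarrow> P *\<^sub>v v \<in> W" "\<And>u. u \<in> W \<Longrightarrow> P *\<^sub>v (Q *\<^sub>v u) = u"
      using subspace_frame[OF W(1)] by metis
    have "e > 0"
    proof (rule ccontr)
      assume "\<not> e > 0"
      then have e0: "e = 0" by simp
      have "u = 0\<^sub>v N" if u: "u \<in> W" for u
      proof -
        have "P *\<^sub>v (Q *\<^sub>v u) = 0\<^sub>v N"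
          using frame(1,2) e0 by (intro eq_vecI) (auto simp: scalar_prod_def)
        then show ?thesis using frame(5)[OF u] by simp
      qed
      then have "W = {0\<^sub>v N}" using W(1) by (auto simp: is_subspace_vec_def)
      then show False using W(2) by simp
    qed
    moreover have "R g * P = P * (Q * (R g * P))" if g: "g \<in> carrier G" for g
    proof (rule mat_eq_on_vecI[of _ N e])
      have RP: "R g * P \<in> carrier_mat N e" using Rc[OF g] frame(1) by auto
      then show "R g * P \<in> carrier_mat N e" "P * (Q * (R g * P)) \<in> carrier_mat N e"
        using frame(1,2) by (auto intro!: mult_carrier_mat[of _ N e])
      fix v :: "complex vec" assume v: "v \<in> carrier_vec e"
      have "(R g * P) *\<^sub>v v \<in> W"
        using assoc_mult_mat_vec[OF Rc[OF g] frame(1) v] inv[OF g frame(4)[OF v]] by simp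
      from frame(5)[OF this] show "(R g * P) *\<^sub>v v = (P * (Q * (R g * P))) *\<^sub>v v"
        using assoc_mult_mat_vec[OF frame(2) RP v]
          assoc_mult_mat_vec[OF frame(1) mult_carrier_mat[OF frame(2) RP] v] by simp
    qed
    ultimately have "ok e" unfolding ok_def using frame(1-4) by blast
    then show ?thesis by blast
  qed
  then obtain d where d: "ok d" and least: "\<And>e. e < d \<Longrightarrow> \<not> ok e"
    using exists_least_iff[of ok] by blast
  from d obtain P Q where PQ: "P \<in> carrier_mat N d" "Q \<in> carrier_mat d N" "Q * P = 1\<^sub>m d"
    and PW: "\<And>v. v \<in> carrier_vec d \<Longrightarrow> P *\<^sub>v v \<in> W"
    and RP: "\<And>g. g \<in> carrier G \<Longrightarrow> R g * P = P * (Q * (R g * P))" and d0: "d > 0"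
    unfolding ok_def by blast
  define \<rho> where "\<rho> g = Q * (R g * P)" for g
  have \<rho>c: "\<rho> g \<in> carrier_mat d d" if "g \<in> carrier G" for g
    using mult_carrier_mat[OF PQ(2) mult_carrier_mat[OF Rc[OF that] PQ(1)]] by (simp add: \<rho>_def)
  have RP\<rho>: "R g * P = P * \<rho> g" if "g \<in> carrier G" for g
    using RP[OF that] by (simp add: \<rho>_def)
  have rep: "is_rep G d \<rho>" unfolding is_rep_def
  proof (intro conjI ballI)
    show "\<rho> \<one> = 1\<^sub>m d" using PQ is_repD(2)[OF R] by (simp add: \<rho>_def)
    fix g h assume g: "g \<in> carrier G" and h: "h \<in> carrier G"
    note c = Rc[OF g] Rc[OF h] \<rho>c[OF g] \<rho>c[OF h]
    have "\<rho> (g \<otimes> h) = Q * (R g * (R h * P))"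
      unfolding \<rho>_def is_repD(3)[OF R g h] using assoc_mult_mat[OF c(1,2) PQ(1)] by simp
    also have "R h * P = P * \<rho> h" by (rule RP\<rho>[OF h])
    also have "R g * (P * \<rho> h) = (R g * P) * \<rho> h"
      by (rule assoc_mult_mat[symmetric, OF c(1) PQ(1) c(4)])
    also have "Q * ((R g * P) * \<rho> h) = (Q * (R g * P)) * \<rho> h"
      by (rule assoc_mult_mat[symmetric, OF PQ(2) mult_carrier_mat[OF c(1) PQ(1)] c(4)])
    finally show "\<rho> (g \<otimes> h) = \<rho> g * \<rho> h" by (simp add: \<rho>_def)
  qed (rule \<rho>c)
  moreover have "U = {0\<^sub>v d} \<or> U = carrier_vec d"
    if U: "is_subspace_vec d U" and Uinv: "\<forall>g \<in> carrier G. \<forall>w \<in> U. \<rho> g *\<^sub>v w \<in> U" for U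
  proof -
    obtain e P' Q' where e: "e \<le> d" and frame: "P' \<in> carrier_mat d e" "Q' \<in> carrier_mat e d"
      "Q' * P' = 1\<^sub>m e"
      "\<And>v. v \<in> carrier_vec e \<Longrightarrow> P' *\<^sub>v v \<in> U" "\<And>u. u \<in> U \<Longrightarrow> P' *\<^sub>v (Q' *\<^sub>v u) = u"
      using subspace_frame[OF U] by metis
    have Ud: "U \<subseteq> carrier_vec d" using U by (simp add: is_subspace_vec_def)
    consider "e = 0" | "e = d" | "0 < e" "e < d" using e by linarith
    then show ?thesis
    proof cases
      case 1
      have "u = 0\<^sub>v d" if u: "u \<in> U" for u
      proof -
        have "P' *\<^sub>v (Q' *\<^sub>v u) = 0\<^sub>v d"
          using frame(1,2) 1 by (intro eq_vecI) (auto simp: scalar_prod_def)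
        then show ?thesis using frame(5)[OF u] by simp
      qed
      then have "U = {0\<^sub>v d}" using U by (auto simp: is_subspace_vec_def)
      then show ?thesis by simp
    next
      case 2
      then have "P' * Q' = 1\<^sub>m d"
        using mat_mult_left_right_inverse[of Q' d P'] frame(1-3) by simp
      then have "u \<in> U" if u: "u \<in> carrier_vec d" for u
        using frame(4)[of "Q' *\<^sub>v u"] assoc_mult_mat_vec[OF frame(1,2) u] frame(2) u by simp
      then show ?thesis using Ud by blast
    next
      case 3
      \<comment> \<open>The frame of \<open>U\<close> composed with that of the ambient subspace is
        an invariant frame inside \<open>W\<close> with fewer columns, against the choice of
        \<open>d\<close>.\<close>
      define P2 where "P2 = P * P'"
      define Q2 where "Q2 = Q' * Q"
      have c: "P2 \<in> carrier_mat N e" "Q2 \<in> carrier_mat e N"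
        using PQ frame by (auto simp: P2_def Q2_def)
      have QP2: "Q * P2 = P'"
        unfolding P2_def using assoc_mult_mat[OF PQ(2,1) frame(1)] PQ(3) frame(1) by simp
      have "Q2 * P2 = 1\<^sub>m e"
        unfolding Q2_def using assoc_mult_mat[OF frame(2) PQ(2) c(1)] QP2 frame(3) by simp
      moreover have "P2 *\<^sub>v v \<in> W" if "v \<in> carrier_vec e" for v
        unfolding P2_def using assoc_mult_mat_vec[OF PQ(1) frame(1) that] PW frame(1) that by simp
      moreover have "R g * P2 = P2 * (Q2 * (R g * P2))" if g: "g \<in> carrier G" for g
      proof -
        note \<rho>P = mult_carrier_mat[OF \<rho>c[OF g] frame(1)]
        have 1: "\<rho> g * P' = P' * (Q' * (\<rho> g * P'))"
        proof (rule mat_eq_on_vecI[OF \<rho>P])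
          show "P' * (Q' * (\<rho> g * P')) \<in> carrier_mat d e"
            by (rule mult_carrier_mat[OF frame(1) mult_carrier_mat[OF frame(2) \<rho>P]])
          fix v :: "complex vec" assume v: "v \<in> carrier_vec e"
          have "(\<rho> g * P') *\<^sub>v v \<in> U"
            using assoc_mult_mat_vec[OF \<rho>c[OF g] frame(1) v] Uinv g frame(4)[OF v] by simp
          from frame(5)[OF this] show "(\<rho> g * P') *\<^sub>v v = (P' * (Q' * (\<rho> g * P'))) *\<^sub>v v"
            using assoc_mult_mat_vec[OF frame(2) \<rho>P v]
              assoc_mult_mat_vec[OF frame(1) mult_carrier_mat[OF frame(2) \<rho>P] v] by simp
        qed
        have 2: "R g * P2 = P * (\<rho> g * P')"
          unfolding P2_def using assoc_mult_mat[OF Rc[OF g] PQ(1) frame(1)] RP\<rho>[OF g]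
            assoc_mult_mat[OF PQ(1) \<rho>c[OF g] frame(1)] by simp
        have 3: "Q2 * (R g * P2) = Q' * (\<rho> g * P')"
          unfolding 2 Q2_def
          using assoc_mult_mat[OF frame(2) PQ(2) mult_carrier_mat[OF PQ(1) \<rho>P]]
            assoc_mult_mat[OF PQ(2,1) \<rho>P] PQ(3) \<rho>P
          by (metis left_mult_one_mat)
        show ?thesis
          unfolding 3 unfolding 2
          using 1 assoc_mult_mat[OF PQ(1) frame(1) mult_carrier_mat[OF frame(2) \<rho>P]]
          by (simp add: P2_def)
      qed
      ultimately have "ok e" unfolding ok_def using 3 c by blast
      then show ?thesis using least[OF 3(2)] by simp
    qed
  qed
  ultimately have "irreducible_rep G d \<rho>" using d0 unfolding irreducible_rep_def by blast
  then show ?thesis using that PQ PW RP\<rho> by blast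
qed

section \<open>The regular representation and operators defined by class functions\<close>

text \<open>Left translations act by permutation matrices, and translation by an element other than
  the identity has no fixed point.\<close>

lemma regular_rep:
  assumes fin: "finite (carrier G)"
  obtains N R where "N = card (carrier G)" "is_rep G N R"
    "\<And>g. g \<in> carrier G \<Longrightarrow> mat_trace (R g) = (if g = \<one> then of_nat N else 0)"
proof -
  define N where "N = card (carrier G)"
  obtain b where b: "bij_betw b {0..<N} (carrier G)"
    using ex_bij_betw_nat_finite[OF fin] by (auto simp: N_def)
  have bc: "b i \<in> carrier G" if "i < N" for i using b that by (auto simp: bij_betw_def)
  have binj: "b i = b j \<longleftrightarrow> i = j" if "i < N" "j < N" for i j
    using b that by (auto simp: bij_betw_def inj_on_def)
  define R where "R g = mat N N (\<lambda>(i, j). if b i = g \<otimes> b j then 1 else (0 :: complex))" for g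
  have "is_rep G N R" unfolding is_rep_def
  proof (intro conjI ballI)
    show "R \<one> = 1\<^sub>m N" by (intro eq_matI) (auto simp: R_def bc binj)
    fix g h assume g: "g \<in> carrier G" and h: "h \<in> carrier G"
    show "R (g \<otimes> h) = R g * R h"
    proof (rule eq_matI)
      fix i j assume "i < dim_row (R g * R h)" "j < dim_col (R g * R h)"
      then have ij: "i < N" "j < N" by (auto simp: R_def)
      obtain k where k: "k < N" "b k = h \<otimes> b j"
        using b h bc[OF ij(2)] by (metis atLeastLessThan_iff bij_betw_imp_surj_on imageE m_closed)
      have "(R g * R h) $$ (i, j) = (\<Sum>m\<in>{0..<N}. (if b i = g \<otimes> b m then 1 else 0) * (if b m = h \<otimes> b j then 1 else 0))"
        using ij by (simp add: R_def scalar_prod_def)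
      also have "\<dots> = (\<Sum>m\<in>{0..<N}. if m = k then (if b i = g \<otimes> b m then 1 else 0) else 0)"
        using k binj by (intro sum.cong) (auto simp flip: k(2))
      also have "\<dots> = R (g \<otimes> h) $$ (i, j)"
        using k ij g h bc by (simp add: R_def m_assoc)
      finally show "R (g \<otimes> h) $$ (i, j) = (R g * R h) $$ (i, j)" by simp
    qed (auto simp: R_def)
  qed (simp add: R_def)
  moreover have "mat_trace (R g) = (if g = \<one> then of_nat N else 0)" if g: "g \<in> carrier G" for g
  proof -
    have "mat_trace (R g) = (\<Sum>i<N. if g = \<one> then 1 else 0)"
      unfolding mat_trace_def
    proof (rule sum.cong)
      fix i assume "i \<in> {..<N}"
      then have i: "i < N" by simp
      have "b i = g \<otimes> b i \<longleftrightarrow> g = \<one>" using g bc[OF i] by (metis l_one one_closed right_cancel)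
      then show "R g $$ (i, i) = (if g = \<one> then 1 else 0)" using i by (simp add: R_def)
    qed (simp add: R_def)
    then show ?thesis by simp
  qed
  ultimately show ?thesis using that N_def by blast
qed

text \<open>The operator by which the element of the group algebra with coefficients
  \<open>f\<close> acts.\<close>

definition rep_sum :: "nat \<Rightarrow> ('a \<Rightarrow> complex) \<Rightarrow> ('a \<Rightarrow> complex mat) \<Rightarrow> complex mat" where
  "rep_sum d f \<rho> = mat_sum d d (\<lambda>g. f g \<cdot>\<^sub>m \<rho> g) (carrier G)"

lemma rep_sum_carrier [simp]: "rep_sum d f \<rho> \<in> carrier_mat d d"
  by (simp add: rep_sum_def)

lemma rep_sum_commutes:
  assumes \<rho>: "is_rep G d \<rho>" and h: "h \<in> carrier G"
    and cls: "\<And>g h. g \<in> carrier G \<Longrightarrow> h \<in> carrier G \<Longrightarrow> f (inv h \<otimes> g \<otimes> h) = f g"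
  shows "\<rho> h * rep_sum d f \<rho> = rep_sum d f \<rho> * \<rho> h"
proof -
  note R = is_repD[OF \<rho>]
  have "\<rho> h * rep_sum d f \<rho> = mat_sum d d (\<lambda>g. \<rho> h * (f g \<cdot>\<^sub>m \<rho> g)) (carrier G)"
    unfolding rep_sum_def by (rule mult_mat_sum[OF R(1)[OF h]]) (simp add: R(1))
  also have "\<dots> = mat_sum d d (\<lambda>g. f g \<cdot>\<^sub>m \<rho> (h \<otimes> g)) (carrier G)"
  proof (rule mat_sum_cong)
    fix g assume g: "g \<in> carrier G"
    show "\<rho> h * (f g \<cdot>\<^sub>m \<rho> g) = f g \<cdot>\<^sub>m \<rho> (h \<otimes> g)"
      unfolding R(3)[OF h g] by (rule mult_smult_distrib[OF R(1)[OF h] R(1)[OF g]])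
  qed
  \<comment> \<open>Replacing g by its conjugate under \<open>h\<close> turns h g into g h and
    leaves the class function \<open>f\<close> unchanged.\<close>
  also have "\<dots> = mat_sum d d (\<lambda>g. (\<lambda>g. f g \<cdot>\<^sub>m \<rho> (h \<otimes> g)) (inv h \<otimes> g \<otimes> h)) (carrier G)"
  proof (rule mat_sum_reindex[symmetric])
    have "h \<otimes> (inv h \<otimes> x) = x" "inv h \<otimes> (h \<otimes> x) = x" if "x \<in> carrier G" for x
      using h that by (simp_all add: m_assoc[symmetric])
    then show "bij_betw (\<lambda>g. inv h \<otimes> g \<otimes> h) (carrier G) (carrier G)"
      using h by (intro bij_betwI[of _ _ _ "\<lambda>g. h \<otimes> g \<otimes> inv h"])
        (auto simp: m_assoc)
  qed
  also have "\<dots> = mat_sum d d (\<lambda>g. (f g \<cdot>\<^sub>m \<rho> g) * \<rho> h) (carrier G)"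
  proof (rule mat_sum_cong)
    fix g assume g: "g \<in> carrier G"
    have "h \<otimes> (inv h \<otimes> g \<otimes> h) = g \<otimes> h"
      using g h by (simp add: m_assoc[symmetric])
    then show "(\<lambda>g. f g \<cdot>\<^sub>m \<rho> (h \<otimes> g)) (inv h \<otimes> g \<otimes> h) = (f g \<cdot>\<^sub>m \<rho> g) * \<rho> h"
      using cls[OF g h] R(3)[OF g h] mult_smult_assoc_mat[OF R(1)[OF g] R(1)[OF h]] by simp
  qed
  also have "\<dots> = rep_sum d f \<rho> * \<rho> h"
    unfolding rep_sum_def by (rule mat_sum_mult[symmetric, OF R(1)[OF h]]) (simp add: R(1))
  finally show ?thesis .
qed

lemma rep_sum_intertwines:
  assumes R: "is_rep G N R" and \<rho>: "is_rep G d \<rho>" and P: "P \<in> carrier_mat N d"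
    and RP: "\<And>g. g \<in> carrier G \<Longrightarrow> R g * P = P * \<rho> g"
  shows "rep_sum N f R * P = P * rep_sum d f \<rho>"
proof -
  have "rep_sum N f R * P = mat_sum N d (\<lambda>g. (f g \<cdot>\<^sub>m R g) * P) (carrier G)"
    unfolding rep_sum_def by (rule mat_sum_mult[OF P]) (simp add: is_repD(1)[OF R])
  also have "\<dots> = mat_sum N d (\<lambda>g. P * (f g \<cdot>\<^sub>m \<rho> g)) (carrier G)"
  proof (rule mat_sum_cong)
    fix g assume g: "g \<in> carrier G"
    show "(f g \<cdot>\<^sub>m R g) * P = P * (f g \<cdot>\<^sub>m \<rho> g)"
      using RP[OF g] mult_smult_assoc_mat[OF is_repD(1)[OF R g] P]
        mult_smult_distrib[OF P is_repD(1)[OF \<rho> g]] by simp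
  qed
  also have "\<dots> = P * rep_sum d f \<rho>"
    unfolding rep_sum_def by (rule mult_mat_sum[symmetric, OF P]) (simp add: is_repD(1)[OF \<rho>])
  finally show ?thesis .
qed

lemma trace_rep_sum:
  assumes "is_rep G d \<rho>"
  shows "mat_trace (rep_sum d f \<rho>) = (\<Sum>g\<in>carrier G. f g * mat_trace (\<rho> g))"
proof -
  have "mat_trace (rep_sum d f \<rho>) = (\<Sum>g\<in>carrier G. mat_trace (f g \<cdot>\<^sub>m \<rho> g))"
    unfolding rep_sum_def using is_repD(1)[OF assms] by (intro mat_trace_sum) auto
  also have "\<dots> = (\<Sum>g\<in>carrier G. f g * mat_trace (\<rho> g))"
    by (intro sum.cong refl mat_trace_smult) (rule is_repD(1)[OF assms])
  finally show ?thesis .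
qed

text \<open>By Schur's lemma the operator is a scalar, and its trace is the sum in
  \<open>orth\<close>.\<close>

lemma rep_sum_irreducible_zero:
  assumes \<rho>: "irreducible_rep G d \<rho>"
    and cls: "\<And>g h. g \<in> carrier G \<Longrightarrow> h \<in> carrier G \<Longrightarrow> f (inv h \<otimes> g \<otimes> h) = f g"
    and orth: "(\<Sum>g\<in>carrier G. f g * mat_trace (\<rho> g)) = 0"
  shows "rep_sum d f \<rho> = 0\<^sub>m d d"
proof -
  note rep = irreducible_repD(1)[OF \<rho>]
  obtain k where k: "rep_sum d f \<rho> = k \<cdot>\<^sub>m 1\<^sub>m d"
    using schur_scalar[OF \<rho> rep_sum_carrier rep_sum_commutes[OF rep _ cls]] by blast
  have "k * of_nat d = 0"
    using trace_rep_sum[OF rep, of f] orth k by (simp add: mat_trace_smult[OF one_carrier_mat])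
  then show ?thesis using irreducible_repD(2)[OF \<rho>] unfolding k by (intro eq_matI) auto
qed

text \<open>Let \<open>Z\<close> be the central operator that \<open>f\<close> defines on the regular representation and \<open>Z'\<close> the
  one defined by \<open>g \<mapsto> cnj (f (inv g))\<close>. The trace of \<open>Z * Z'\<close> is \<open>card G\<close> times the squared norm of
  \<open>f\<close>. If it is nonzero, \<open>Z * Z'\<close> has an eigenspace for a nonzero eigenvalue, and an irreducible
  subrepresentation of that eigenspace cannot be annihilated by \<open>Z\<close>. This avoids Maschke's theorem.\<close>

theorem class_function_zero:
  assumes fin: "finite (carrier G)"
    and cls: "\<And>g h. g \<in> carrier G \<Longrightarrow> h \<in> carrier G \<Longrightarrow> f (inv h \<otimes> g \<otimes> h) = f g"
    and orth: "\<And>d \<rho>. irreducible_rep G d \<rho> \<Longrightarrow> (\<Sum>g\<in>carrier G. f g * mat_trace (\<rho> g)) = 0"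
    and g: "g \<in> carrier G"
  shows "f g = 0"
proof (rule ccontr)
  assume "f g \<noteq> 0"
  obtain N R where N: "N = card (carrier G)" and R: "is_rep G N R"
    and trR: "\<And>g. g \<in> carrier G \<Longrightarrow> mat_trace (R g) = (if g = \<one> then of_nat N else 0)"
    using regular_rep[OF fin] by metis
  have N0: "N > 0" using fin g N card_gt_0_iff by blast
  define f' where "f' g = cnj (f (inv g))" for g
  have cls': "f' (inv h \<otimes> g \<otimes> h) = f' g" if "g \<in> carrier G" "h \<in> carrier G" for g h
    using cls[of "inv g" h] that by (simp add: f'_def inv_mult_group m_assoc)
  define Z where "Z = rep_sum N f R"
  define Z' where "Z' = rep_sum N f' R"
  have c: "Z \<in> carrier_mat N N" "Z' \<in> carrier_mat N N" by (simp_all add: Z_def Z'_def)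
  have "mat_trace (Z * Z') = (\<Sum>h\<in>carrier G. f h * mat_trace (R h * Z'))"
  proof -
    have "Z * Z' = mat_sum N N (\<lambda>h. (f h \<cdot>\<^sub>m R h) * Z') (carrier G)"
      unfolding Z_def rep_sum_def by (rule mat_sum_mult[OF c(2)]) (simp add: is_repD(1)[OF R])
    moreover have "(f h \<cdot>\<^sub>m R h) * Z' \<in> carrier_mat N N" if "h \<in> carrier G" for h
      using mult_carrier_mat[OF smult_carrier_mat[OF is_repD(1)[OF R that]] c(2)] .
    ultimately have "mat_trace (Z * Z') = (\<Sum>h\<in>carrier G. mat_trace ((f h \<cdot>\<^sub>m R h) * Z'))"
      by (simp only: mat_trace_sum)
    also have "\<dots> = (\<Sum>h\<in>carrier G. f h * mat_trace (R h * Z'))"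
    proof (rule sum.cong)
      fix h assume h: "h \<in> carrier G"
      note Rh = is_repD(1)[OF R h]
      show "mat_trace ((f h \<cdot>\<^sub>m R h) * Z') = f h * mat_trace (R h * Z')"
        unfolding mult_smult_assoc_mat[OF Rh c(2)]
        by (rule mat_trace_smult[OF mult_carrier_mat[OF Rh c(2)]])
    qed simp
    finally show ?thesis .
  qed
  also have "\<dots> = (\<Sum>h\<in>carrier G. f h * (of_nat N * cnj (f h)))"
  proof (rule sum.cong)
    fix h assume h: "h \<in> carrier G"
    note Rh = is_repD(1)[OF R h]
    have "R h * Z' = mat_sum N N (\<lambda>k. R h * (f' k \<cdot>\<^sub>m R k)) (carrier G)"
      unfolding Z'_def rep_sum_def by (rule mult_mat_sum[OF Rh]) (simp add: is_repD(1)[OF R])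
    moreover have "R h * (f' k \<cdot>\<^sub>m R k) \<in> carrier_mat N N" if "k \<in> carrier G" for k
      using mult_carrier_mat[OF Rh smult_carrier_mat[OF is_repD(1)[OF R that]]] .
    ultimately have "mat_trace (R h * Z') = (\<Sum>k\<in>carrier G. mat_trace (R h * (f' k \<cdot>\<^sub>m R k)))"
      by (simp only: mat_trace_sum)
    \<comment> \<open>The regular character is concentrated at the identity, so only k = inv h
      contributes.\<close>
    also have "\<dots> = (\<Sum>k\<in>carrier G. if k = inv h then f' k * of_nat N else 0)"
    proof (rule sum.cong)
      fix k assume k: "k \<in> carrier G"
      note Rk = is_repD(1)[OF R k]
      have "R h * (f' k \<cdot>\<^sub>m R k) = f' k \<cdot>\<^sub>m R (h \<otimes> k)"
        unfolding is_repD(3)[OF R h k] by (rule mult_smult_distrib[OF Rh Rk])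
      then have "mat_trace (R h * (f' k \<cdot>\<^sub>m R k)) = f' k * mat_trace (R (h \<otimes> k))"
        using mat_trace_smult[OF is_repD(1)[OF R m_closed[OF h k]]] by simp
      moreover have "h \<otimes> k = \<one> \<longleftrightarrow> k = inv h"
        using h k by (metis inv_equality inv_inv inv_closed r_inv)
      ultimately show "mat_trace (R h * (f' k \<cdot>\<^sub>m R k)) = (if k = inv h then f' k * of_nat N else 0)"
        using trR[OF m_closed[OF h k]] by simp
    qed simp
    also have "\<dots> = of_nat N * cnj (f h)" using fin h by (simp add: f'_def)
    finally show "f h * mat_trace (R h * Z') = f h * (of_nat N * cnj (f h))" by simp
  qed simp
  also have "\<dots> = of_real (real N * (\<Sum>h\<in>carrier G. (cmod (f h))\<^sup>2))"
    by (simp add: complex_norm_square sum_distrib_left mult.left_commute del: of_real_power)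
  finally have tr: "mat_trace (Z * Z') = of_real (real N * (\<Sum>h\<in>carrier G. (cmod (f h))\<^sup>2))" .
  have "(\<Sum>h\<in>carrier G. (cmod (f h))\<^sup>2) > 0"
    using \<open>f g \<noteq> 0\<close> g by (intro sum_pos2[OF fin g]) auto
  then have "mat_trace (Z * Z') \<noteq> 0" using N0 unfolding tr by (simp only: of_real_eq_0_iff) auto
  moreover have ZZc: "Z * Z' \<in> carrier_mat N N" using c by auto
  ultimately obtain \<mu> where \<mu>: "eigenvalue (Z * Z') \<mu>" "\<mu> \<noteq> 0"
  proof -
    obtain ev where "\<And>k. mat_trace ((Z * Z') ^\<^sub>m k) = (\<Sum>i<N. ev i ^ k)"
      "\<And>i. i < N \<Longrightarrow> eigenvalue (Z * Z') (ev i)"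
      using complex_mat_spectrum[OF ZZc] by metis
    note ev = this(1)[of 1] this(2)
    have "\<exists>i<N. ev i \<noteq> 0"
    proof (rule ccontr)
      assume "\<not> (\<exists>i<N. ev i \<noteq> 0)"
      then have "mat_trace (Z * Z') = 0" using ev(1) ZZc by simp
      then show False using \<open>mat_trace (Z * Z') \<noteq> 0\<close> by simp
    qed
    then show ?thesis using ev(2) that by blast
  qed
  define W where "W = {v \<in> carrier_vec N. (Z * Z') *\<^sub>v v = \<mu> \<cdot>\<^sub>v v}"
  have W: "is_subspace_vec N W"
    using ZZc unfolding W_def is_subspace_vec_def
    by (auto simp: mult_add_distrib_mat_vec[OF ZZc] mult_mat_vec[OF ZZc] smult_add_distrib_vec
        smult_smult_assoc mult.commute)
  have W0: "W \<noteq> {0\<^sub>v N}"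
    using \<mu>(1) carrier_matD(1)[OF c(1)] by (auto simp: W_def eigenvalue_def eigenvector_def)
  have inv: "R h *\<^sub>v w \<in> W" if h: "h \<in> carrier G" and w: "w \<in> W" for h w
  proof -
    note Rh = is_repD(1)[OF R h]
    have wN: "w \<in> carrier_vec N" using w by (simp add: W_def)
    have "R h * Z = Z * R h" "R h * Z' = Z' * R h"
      unfolding Z_def Z'_def using rep_sum_commutes[OF R h] cls cls' by blast+
    then have "(Z * Z') * R h = R h * (Z * Z')"
      using assoc_mult_mat[OF c Rh] assoc_mult_mat[OF c(1) Rh c(2)] assoc_mult_mat[OF Rh c] by simp
    then have "(Z * Z') *\<^sub>v (R h *\<^sub>v w) = R h *\<^sub>v ((Z * Z') *\<^sub>v w)"
      using assoc_mult_mat_vec[OF ZZc Rh wN] assoc_mult_mat_vec[OF Rh ZZc wN] by simp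
    then show ?thesis using w mult_mat_vec[OF Rh wN] Rh by (simp add: W_def)
  qed
  obtain d P Q \<rho> where \<rho>: "irreducible_rep G d \<rho>" and PQ: "P \<in> carrier_mat N d" "Q \<in> carrier_mat d N"
    "Q * P = 1\<^sub>m d" and PW: "\<And>v. v \<in> carrier_vec d \<Longrightarrow> P *\<^sub>v v \<in> W"
    and RP: "\<And>g. g \<in> carrier G \<Longrightarrow> R g * P = P * \<rho> g"
    using irreducible_subrep[OF R W W0 inv] by metis
  note rep = irreducible_repD(1)[OF \<rho>]
  have "Z * P = P * rep_sum d f \<rho>" "Z' * P = P * rep_sum d f' \<rho>"
    unfolding Z_def Z'_def using rep_sum_intertwines[OF R rep PQ(1) RP] by blast+
  then have "(Z * Z') * P = (P * rep_sum d f \<rho>) * rep_sum d f' \<rho>"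
    using assoc_mult_mat[OF c PQ(1)] assoc_mult_mat[OF c(1) PQ(1) rep_sum_carrier] by simp
  also have "\<dots> = 0\<^sub>m N d"
    using rep_sum_irreducible_zero[OF \<rho> cls orth[OF \<rho>]] PQ(1)
    by (simp add: left_mult_zero_mat[OF rep_sum_carrier])
  finally have ZP: "(Z * Z') * P = 0\<^sub>m N d" .
  \<comment> \<open>On the nonzero vector P v the product of \<open>Z\<close> and \<open>Z'\<close>
    acts both as \<mu> and as 0; applying \<open>Q\<close> carries the contradiction back to
    \<open>v\<close>.\<close>
  define v where "v = (unit_vec d 0 :: complex vec)"
  have v: "v \<in> carrier_vec d" by (simp add: v_def)
  have Pv: "P *\<^sub>v v \<in> carrier_vec N" using PQ(1) v by simp
  have "\<mu> \<cdot>\<^sub>v (P *\<^sub>v v) = (Z * Z') *\<^sub>v (P *\<^sub>v v)" using PW[OF v] by (simp add: W_def)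
  also have "\<dots> = 0\<^sub>m N d *\<^sub>v v" using assoc_mult_mat_vec[OF ZZc PQ(1) v] ZP by simp
  also have "\<dots> = 0\<^sub>v N" using v by (intro eq_vecI) (auto simp: scalar_prod_def)
  finally have "Q *\<^sub>v (\<mu> \<cdot>\<^sub>v (P *\<^sub>v v)) = 0\<^sub>v d" using PQ(2) by simp
  then have "\<mu> \<cdot>\<^sub>v v = 0\<^sub>v d"
    using mult_mat_vec[OF PQ(2) Pv] assoc_mult_mat_vec[OF PQ(2,1) v] PQ(3) v by simp
  then have "\<mu> * v $ 0 = 0"
    using irreducible_repD(2)[OF \<rho>] v by (metis carrier_vecD index_smult_vec(1) index_zero_vec(1))
  then show False using \<mu>(2) irreducible_repD(2)[OF \<rho>] by (simp add: v_def)
qed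

end

section \<open>The critical group\<close>

text \<open>The map \<open>s\<close> need only be a homomorphism modulo \<open>I\<close>. This suits
  residues given by integer representatives, whose sums wrap around.\<close>

lemma (in comm_group) embedding_into_quotient:
  assumes I: "subgroup I G" and P: "group P"
    and s: "\<And>a. a \<in> carrier P \<Longrightarrow> s a \<in> carrier G"
    and hom: "\<And>a b. a \<in> carrier P \<Longrightarrow> b \<in> carrier P \<Longrightarrow> I #> s (a \<otimes>\<^bsub>P\<^esub> b) = I #> (s a \<otimes> s b)"
    and inj: "\<And>a b. a \<in> carrier P \<Longrightarrow> b \<in> carrier P \<Longrightarrow> I #> s a = I #> s b \<Longrightarrow> a = b"
  shows "\<exists>H. subgroup H (G Mod I) \<and> (G Mod I)\<lparr>carrier := H\<rparr> \<cong> P"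
proof -
  interpret I: normal I G by (rule subgroup_imp_normal[OF I])
  have Q: "group (G Mod I)" by (rule I.factorgroup_is_group)
  define \<phi> where "\<phi> a = I #> s a" for a
  have \<phi>: "\<phi> \<in> hom P (G Mod I)"
  proof (rule homI)
    show "\<phi> a \<in> carrier (G Mod I)" if "a \<in> carrier P" for a
      using rcosetsI[OF I.subset s[OF that]] by (simp add: \<phi>_def FactGroup_def)
    show "\<phi> (a \<otimes>\<^bsub>P\<^esub> b) = \<phi> a \<otimes>\<^bsub>G Mod I\<^esub> \<phi> b" if "a \<in> carrier P" "b \<in> carrier P" for a b
      using I.rcos_sum[OF s s, OF that] hom[OF that] by (simp add: \<phi>_def FactGroup_def)
  qed
  interpret \<phi>: group_hom P "G Mod I" \<phi>
    using P Q \<phi> by (simp add: group_hom_def group_hom_axioms_def)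
  define H where "H = \<phi> ` carrier P"
  have H: "subgroup H (G Mod I)" unfolding H_def by (rule \<phi>.img_is_subgroup)
  have "\<phi> \<in> iso P ((G Mod I)\<lparr>carrier := H\<rparr>)"
    using \<phi> inj by (auto simp: iso_def hom_def bij_betw_def inj_on_def \<phi>_def H_def)
  then have "P \<cong> (G Mod I)\<lparr>carrier := H\<rparr>" by (auto simp: is_iso_def)
  then show ?thesis using H group.iso_sym[OF P] by blast
qed

lemma int_lattice_simps:
  "x \<in> carrier (int_lattice l) \<longleftrightarrow> (\<forall>i. i \<notin> {1..l} \<longrightarrow> x i = 0)"
  "x \<otimes>\<^bsub>int_lattice l\<^esub> y = (\<lambda>i. x i + y i)"
  "\<one>\<^bsub>int_lattice l\<^esub> = (\<lambda>_. 0)"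
  by (auto simp: int_lattice_def)

lemma comm_group_int_lattice: "comm_group (int_lattice l)"
proof (rule comm_groupI)
  fix x assume "x \<in> carrier (int_lattice l)"
  then show "\<exists>y\<in>carrier (int_lattice l). y \<otimes>\<^bsub>int_lattice l\<^esub> x = \<one>\<^bsub>int_lattice l\<^esub>"
    by (intro bexI[of _ "\<lambda>i. - x i"]) (auto simp: int_lattice_simps)
qed (auto simp: int_lattice_simps add.assoc add.commute)

lemma inv_int_lattice:
  assumes "x \<in> carrier (int_lattice l)"
  shows "inv\<^bsub>int_lattice l\<^esub> x = (\<lambda>i. - x i)"
proof -
  interpret comm_group "int_lattice l" by (rule comm_group_int_lattice)
  show ?thesis using assms by (intro inv_equality) (auto simp: int_lattice_simps)
qed

definition cartan_transpose :: "nat \<Rightarrow> nat \<Rightarrow> (nat \<Rightarrow> nat \<Rightarrow> int) \<Rightarrow> (nat \<Rightarrow> int) \<Rightarrow> nat \<Rightarrow> int" where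
  "cartan_transpose l n M x = (\<lambda>i. if i \<in> {1..l} then (\<Sum>j\<in>{1..l}. ext_mckay_cartan n M j i * x j) else 0)"

lemma mckay_cartan_transpose_image_eq:
  "mckay_cartan_transpose_image l n M = cartan_transpose l n M ` carrier (int_lattice l)"
  by (simp add: mckay_cartan_transpose_image_def cartan_transpose_def)

lemma cartan_transpose_linear:
  "cartan_transpose l n M (\<lambda>i. a * x i + b * y i) =
    (\<lambda>i. a * cartan_transpose l n M x i + b * cartan_transpose l n M y i)"
  by (auto simp: cartan_transpose_def sum.distrib sum_distrib_left algebra_simps)

lemma subgroup_mckay_cartan_transpose_image:
  "subgroup (mckay_cartan_transpose_image l n M) (int_lattice l)"
proof -
  interpret comm_group "int_lattice l" by (rule comm_group_int_lattice)
  let ?C = "cartan_transpose l n M"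
  show ?thesis unfolding mckay_cartan_transpose_image_eq
  proof (rule subgroupI)
    show "?C ` carrier (int_lattice l) \<subseteq> carrier (int_lattice l)"
      by (auto simp: int_lattice_simps cartan_transpose_def)
    then show "inv\<^bsub>int_lattice l\<^esub> a \<in> ?C ` carrier (int_lattice l)"
      if a: "a \<in> ?C ` carrier (int_lattice l)" for a
    proof -
      obtain x where x: "x \<in> carrier (int_lattice l)" "a = ?C x" using a by blast
      have "inv\<^bsub>int_lattice l\<^esub> a = ?C (\<lambda>i. (- 1) * x i + 0 * x i)"
        unfolding cartan_transpose_linear using inv_int_lattice[of a l] x
        by (auto simp: int_lattice_simps cartan_transpose_def)
      then show ?thesis by (simp only:) (rule imageI, use x in \<open>auto simp: int_lattice_simps\<close>)
    qed
    show "a \<otimes>\<^bsub>int_lattice l\<^esub> b \<in> ?C ` carrier (int_lattice l)"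
      if ab: "a \<in> ?C ` carrier (int_lattice l)" "b \<in> ?C ` carrier (int_lattice l)" for a b
    proof -
      obtain x y where x: "x \<in> carrier (int_lattice l)" "a = ?C x"
        and y: "y \<in> carrier (int_lattice l)" "b = ?C y" using ab by blast
      have "a \<otimes>\<^bsub>int_lattice l\<^esub> b = ?C (\<lambda>i. 1 * x i + 1 * y i)"
        unfolding cartan_transpose_linear using x y by (simp add: int_lattice_simps)
      then show ?thesis by (simp only:) (rule imageI, use x y in \<open>auto simp: int_lattice_simps\<close>)
    qed
  qed (auto simp: int_lattice_simps intro!: exI[of _ "\<lambda>_. 0"])
qed

text \<open>By \<open>rel\<close>, two integer combinations of the vectors \<open>w j\<close> agree
  in the cokernel exactly when their coefficients are congruent modulo \<open>k\<close>. So sending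
  a tuple of residues to the combination with these coefficients is an embedding.\<close>

lemma critical_group_power_subgroup:
  fixes w :: "nat \<Rightarrow> nat \<Rightarrow> int"
  assumes w: "\<And>j. j < r \<Longrightarrow> w j \<in> carrier (int_lattice l)"
    and rel: "\<And>a. (\<lambda>i. \<Sum>j<r. a j * w j i) \<in> mckay_cartan_transpose_image l n M \<longleftrightarrow>
      (\<forall>j<r. int k dvd a j)"
  shows "\<exists>H. subgroup H (critical_group l n M) \<and>
    (critical_group l n M)\<lparr>carrier := H\<rparr> \<cong> product_group {..<r} (\<lambda>_. integer_mod_group k)"
proof -
  let ?I = "mckay_cartan_transpose_image l n M"
  let ?P = "product_group {..<r} (\<lambda>_. integer_mod_group k)"
  interpret L: comm_group "int_lattice l" by (rule comm_group_int_lattice)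
  interpret I: subgroup ?I "int_lattice l" by (rule subgroup_mckay_cartan_transpose_image)
  define s where "s a = (\<lambda>i. \<Sum>j<r. a j * w j i)" for a :: "nat \<Rightarrow> int"
  have s: "s a \<in> carrier (int_lattice l)" for a
    using w by (auto simp: s_def int_lattice_simps)
  have diff: "?I #>\<^bsub>int_lattice l\<^esub> s a = ?I #>\<^bsub>int_lattice l\<^esub> s b \<longleftrightarrow> (\<forall>j<r. int k dvd a j - b j)" for a b
  proof -
    have "?I #>\<^bsub>int_lattice l\<^esub> s a = ?I #>\<^bsub>int_lattice l\<^esub> s b \<longleftrightarrow> s a \<in> ?I #>\<^bsub>int_lattice l\<^esub> s b"
      using L.repr_independence[OF _ s I.subgroup_axioms] L.rcos_self[OF s I.subgroup_axioms] by metis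
    also have "\<dots> \<longleftrightarrow> s a \<otimes>\<^bsub>int_lattice l\<^esub> inv\<^bsub>int_lattice l\<^esub> s b \<in> ?I"
      by (rule I.rcos_module[OF L.is_group s s])
    also have "s a \<otimes>\<^bsub>int_lattice l\<^esub> inv\<^bsub>int_lattice l\<^esub> s b = (\<lambda>i. \<Sum>j<r. (a j - b j) * w j i)"
      unfolding inv_int_lattice[OF s] int_lattice_simps
      by (simp add: s_def sum_subtractf left_diff_distrib)
    finally show ?thesis unfolding rel .
  qed
  have s_add: "s a \<otimes>\<^bsub>int_lattice l\<^esub> s b = s (\<lambda>j. a j + b j)" for a b
    by (simp add: s_def int_lattice_simps sum.distrib distrib_right)
  show ?thesis unfolding critical_group_def
  proof (rule L.embedding_into_quotient[where s = s])
    show "?I #>\<^bsub>int_lattice l\<^esub> s (a \<otimes>\<^bsub>?P\<^esub> b) = ?I #>\<^bsub>int_lattice l\<^esub> (s a \<otimes>\<^bsub>int_lattice l\<^esub> s b)"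
      if "a \<in> carrier ?P" "b \<in> carrier ?P" for a b
      \<comment> \<open>The product group reduces sums modulo \<open>k\<close>, so both sides have
        congruent coefficients.\<close>
      unfolding s_add diff by (auto simp: mod_eq_dvd_iff[symmetric])
    show "a = b" if ab: "a \<in> carrier ?P" "b \<in> carrier ?P"
      and eq: "?I #>\<^bsub>int_lattice l\<^esub> s a = ?I #>\<^bsub>int_lattice l\<^esub> s b" for a b
    proof (rule PiE_ext)
      show "a \<in> (\<Pi>\<^sub>E i\<in>{..<r}. carrier (integer_mod_group k))"
        "b \<in> (\<Pi>\<^sub>E i\<in>{..<r}. carrier (integer_mod_group k))" using ab by simp_all
      fix j assume j: "j \<in> {..<r}"
      then have dvd: "int k dvd a j - b j" using eq diff by simp
      have "a j \<in> carrier (integer_mod_group k)" "b j \<in> carrier (integer_mod_group k)"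
        using ab j by auto
      \<comment> \<open>Representatives lie in 0..<k, or are arbitrary integers when k = 0; either
        way congruent ones are equal.\<close>
      then show "a j = b j"
        using dvd mod_eq_dvd_iff[of "a j" "int k" "b j"]
        by (auto simp: carrier_integer_mod_group split: if_splits)
    qed
  qed (auto simp: s subgroup_mckay_cartan_transpose_image)
qed

section \<open>Irreducible characters and the McKay matrix\<close>

locale mckay_data = group G for G :: "('g, 'b) monoid_scheme" (structure) +
  fixes n :: nat and \<gamma> :: "'g \<Rightarrow> complex mat"
    and l :: nat and chi :: "nat \<Rightarrow> 'g \<Rightarrow> complex" and M :: "nat \<Rightarrow> nat \<Rightarrow> int"
  assumes fin: "finite (carrier G)"
    and faithful: "faithful_rep G n \<gamma>"
    and real: "\<forall>g \<in> carrier G. character G \<gamma> g \<in> \<real>"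
    and irr: "bij_betw chi {0..l} (irr_chars G)"
    and chi_0: "chi 0 = trivial_char G"
    and M_eq: "\<forall>i \<in> {0..l}. \<forall>g \<in> carrier G.
      character G \<gamma> g * chi i g = (\<Sum>j\<in>{0..l}. of_int (M i j) * chi j g)"
begin

lemma rep: "is_rep G n \<gamma>"
  using faithful by (simp add: faithful_rep_def)

lemma character_one: "character G \<gamma> \<one> = of_nat n"
  using is_repD(2)[OF rep] by (simp add: character_def)

lemma character_inv:
  assumes "g \<in> carrier G"
  shows "character G \<gamma> (inv g) = character G \<gamma> g"
  using rep_trace_properties(1)[OF fin rep assms] real assms
  by (auto simp: character_def Reals_cnj_iff)

text \<open>This makes n - character G \<gamma> g nonzero away from the identity, the source of the
  injectivity of the transposed Cartan matrix.\<close>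

lemma character_eq_dim:
  assumes g: "g \<in> carrier G" and eq: "character G \<gamma> g = of_nat n"
  shows "g = \<one>"
proof -
  have "\<gamma> g = \<gamma> \<one>"
    using rep_trace_properties(3)[OF fin rep g] eq g is_repD(2)[OF rep] by (simp add: character_def)
  then show ?thesis using faithful g by (auto simp: faithful_rep_def inj_on_def)
qed

lemma chi_irreducible:
  assumes "i \<le> l"
  obtains d \<rho> where "irreducible_rep G d \<rho>" "chi i = character G \<rho>"
  using irr assms by (fastforce simp: bij_betw_def irr_chars_def)

lemma chi_orthogonal:
  assumes i: "i \<le> l" and j: "j \<le> l"
  shows "(\<Sum>g\<in>carrier G. chi i g * chi j (inv g)) = (if i = j then of_nat (card (carrier G)) else 0)"
proof -
  obtain d \<rho> where \<rho>: "irreducible_rep G d \<rho>" "chi i = character G \<rho>" using chi_irreducible[OF i] .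
  obtain e \<sigma> where \<sigma>: "irreducible_rep G e \<sigma>" "chi j = character G \<sigma>" using chi_irreducible[OF j] .
  have eq: "(\<Sum>g\<in>carrier G. chi i g * chi j (inv g)) =
      (\<Sum>g\<in>carrier G. mat_trace (\<rho> g) * mat_trace (\<sigma> (inv g)))"
    unfolding \<rho>(2) \<sigma>(2) by (intro sum.cong) (auto simp: character_def)
  show ?thesis
  proof (cases "i = j")
    case True
    have "(\<Sum>g\<in>carrier G. chi i g * chi j (inv g)) =
        (\<Sum>g\<in>carrier G. mat_trace (\<rho> g) * mat_trace (\<rho> (inv g)))"
      unfolding True[symmetric] \<rho>(2) by (intro sum.cong) (auto simp: character_def)
    then show ?thesis using orthogonality_same[OF \<rho>(1)] True by simp
  next
    case False
    then have "chi i \<noteq> chi j" using irr i j by (auto simp: bij_betw_def inj_on_def)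
    \<comment> \<open>Characters are restricted to the carrier, so distinct ones differ at some
      group element.\<close>
    then obtain g where "g \<in> carrier G" "mat_trace (\<rho> g) \<noteq> mat_trace (\<sigma> g)"
      unfolding \<rho>(2) \<sigma>(2) character_def by (metis restrict_ext)
    then show ?thesis using orthogonality_different[OF \<rho>(1) \<sigma>(1)] eq False by simp
  qed
qed

text \<open>Extraction of coefficients. The index set varies because rows of \<open>M\<close> use
  {0..l} and lattice vectors only {1..l}.\<close>

lemma sum_chi_orthogonal:
  assumes "A \<subseteq> {0..l}" "k \<le> l"
  shows "(\<Sum>g\<in>carrier G. (\<Sum>j\<in>A. a j * chi j g) * chi k (inv g)) =
    (if k \<in> A then of_nat (card (carrier G)) * a k else 0)"
proof -
  have finA: "finite A" using assms(1) by (rule finite_subset) simp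
  have "(\<Sum>g\<in>carrier G. (\<Sum>j\<in>A. a j * chi j g) * chi k (inv g)) =
      (\<Sum>j\<in>A. \<Sum>g\<in>carrier G. a j * (chi j g * chi k (inv g)))"
    unfolding sum_distrib_right mult.assoc by (rule sum.swap)
  also have "\<dots> = (\<Sum>j\<in>A. if j = k then of_nat (card (carrier G)) * a j else 0)"
    using chi_orthogonal assms by (intro sum.cong) (auto simp: sum_distrib_left[symmetric] subset_eq)
  also have "\<dots> = (if k \<in> A then of_nat (card (carrier G)) * a k else 0)" using finA by simp
  finally show ?thesis .
qed

lemma card_carrier_nonzero: "card (carrier G) \<noteq> 0"
  using fin one_closed by (metis card_0_eq empty_iff)

text \<open>The entry at (i, k), times the group order, is the sum of character G \<gamma> g * chi i
  g * chi k (inv g). The substitution of inv g for g exchanges i and k, since a real character is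
  invariant under inversion.\<close>

lemma M_symmetric:
  assumes i: "i \<le> l" and k: "k \<le> l"
  shows "M i k = M k i"
proof -
  have *: "(\<Sum>g\<in>carrier G. character G \<gamma> g * chi i g * chi k (inv g)) =
      of_nat (card (carrier G)) * of_int (M i k)" if "i \<le> l" "k \<le> l" for i k
    using sum_chi_orthogonal[of "{0..l}" k "\<lambda>j. of_int (M i j)"] M_eq that by simp
  have "(\<Sum>g\<in>carrier G. character G \<gamma> g * chi i g * chi k (inv g)) =
      (\<Sum>g\<in>carrier G. character G \<gamma> (inv g) * chi i (inv g) * chi k (inv (inv g)))"
  proof (rule sum.reindex_bij_betw[symmetric])
    show "bij_betw (m_inv G) (carrier G) (carrier G)"
      by (rule bij_betwI[of _ _ _ "m_inv G"]) auto
  qed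
  also have "\<dots> = (\<Sum>g\<in>carrier G. character G \<gamma> g * chi k g * chi i (inv g))"
    by (intro sum.cong) (auto simp: character_inv)
  finally have "of_nat (card (carrier G)) * of_int (M i k) =
      (of_nat (card (carrier G)) * of_int (M k i) :: complex)"
    using *[OF i k] *[OF k i] by simp
  then show ?thesis using card_carrier_nonzero by simp
qed

text \<open>The vector \<open>x\<close> is read as the class function \<phi> = sum of x_j chi_j.
  Multiplying \<phi> by n minus the character of \<gamma> applies the extended matrix to the
  coefficients, so on the kernel the product is a constant \<open>t\<close>.\<close>

lemma cartan_transpose_injective:
  assumes x: "x \<in> carrier (int_lattice l)" and ker: "cartan_transpose l n M x = (\<lambda>_. 0)"
  shows "x = (\<lambda>_. 0)"
proof -
  define \<phi> where "\<phi> g = (\<Sum>j\<in>{1..l}. of_int (x j) * chi j g)" for g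
  \<comment> \<open>The coordinate at the trivial character, which \<open>cartan_transpose\<close>
    discards.\<close>
  define t where "t = (\<Sum>j\<in>{1..l}. ext_mckay_cartan n M j 0 * x j)"
  have t: "(of_nat n - character G \<gamma> g) * \<phi> g = of_int t" if g: "g \<in> carrier G" for g
  proof -
    have "(of_nat n - character G \<gamma> g) * chi j g =
        (\<Sum>i\<in>{0..l}. of_int (ext_mckay_cartan n M j i) * chi i g)" if j: "j \<in> {1..l}" for j
    proof -
      have "(\<Sum>i\<in>{0..l}. of_int (ext_mckay_cartan n M j i) * chi i g) =
          (\<Sum>i\<in>{0..l}. (if i = j then of_nat n * chi i g else 0)) - (\<Sum>i\<in>{0..l}. of_int (M j i) * chi i g)"
        unfolding sum_subtractf[symmetric]
        by (intro sum.cong) (auto simp: ext_mckay_cartan_def algebra_simps)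
      then show ?thesis using M_eq j g by (simp add: left_diff_distrib)
    qed
    then have "(of_nat n - character G \<gamma> g) * \<phi> g =
        (\<Sum>j\<in>{1..l}. of_int (x j) * (\<Sum>i\<in>{0..l}. of_int (ext_mckay_cartan n M j i) * chi i g))"
      unfolding \<phi>_def sum_distrib_left
      by (intro sum.cong) (auto simp: mult.left_commute sum_distrib_left[symmetric])
    also have "\<dots> = (\<Sum>i\<in>{0..l}. of_int (\<Sum>j\<in>{1..l}. ext_mckay_cartan n M j i * x j) * chi i g)"
      unfolding sum_distrib_left by (subst sum.swap) (simp add: sum_distrib_left sum_distrib_right mult_ac)
    also have "\<dots> = (\<Sum>i\<in>{0..l}. if i = 0 then of_int t * chi 0 g else 0)"
    proof (rule sum.cong)
      fix i assume i: "i \<in> {0..l}"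
      show "of_int (\<Sum>j\<in>{1..l}. ext_mckay_cartan n M j i * x j) * chi i g =
          (if i = 0 then of_int t * chi 0 g else 0)"
      proof (cases "i = 0")
        case False
        then have "i \<in> {1..l}" using i by auto
        then have "(\<Sum>j\<in>{1..l}. ext_mckay_cartan n M j i * x j) = 0"
          using fun_cong[OF ker, of i] by (simp add: cartan_transpose_def)
        then show ?thesis using False by simp
      qed (simp add: t_def)
    qed simp
    also have "\<dots> = of_int t" using g by (simp add: chi_0 trivial_char_def)
    finally show ?thesis .
  qed
  \<comment> \<open>At the identity the factor n minus the character vanishes, hence so does the
    constant; elsewhere the factor is nonzero, hence \<phi> is 0.\<close>
  have "t = 0" using t[of \<one>] character_one by simp
  then have \<phi>0: "\<phi> g = 0" if "g \<in> carrier G" "g \<noteq> \<one>" for g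
    using t[OF that(1)] character_eq_dim[OF that(1)] that(2) by auto
  \<comment> \<open>The value at the identity is the pairing of \<phi> with the trivial character,
    which is 0 because \<phi> has no trivial component.\<close>
  have "\<phi> \<one> = (\<Sum>g\<in>carrier G. if g = \<one> then \<phi> g else 0)" using fin by simp
  also have "\<dots> = (\<Sum>g\<in>carrier G. \<phi> g * chi 0 (inv g))"
    using \<phi>0 by (intro sum.cong) (auto simp: chi_0 trivial_char_def)
  also have "\<dots> = 0" using sum_chi_orthogonal[of "{1..l}" 0] by (simp add: \<phi>_def)
  finally have \<phi>0': "\<phi> g = 0" if "g \<in> carrier G" for g using \<phi>0 that by blast
  have "x k = 0" if k: "k \<in> {1..l}" for k
    using sum_chi_orthogonal[of "{1..l}" k "\<lambda>j. of_int (x j)"] k \<phi>0' card_carrier_nonzero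
    by (simp add: \<phi>_def)
  then show ?thesis using x by (auto simp: int_lattice_simps)
qed

text \<open>A suitable class function supported on the classes counted is paired with all
  irreducible characters. The pairings form a complex eigenvector that vanishes on \<open>S\<close>
  and at the trivial index, and \<open>integer_kernel_vector\<close> makes it integral. The set
  \<open>S\<close> is that of the rank hypothesis in \<open>saturated_lattice_basis\<close>.\<close>

lemma integer_eigenvector:
  assumes S: "finite S" and card: "card S < card {K \<in> conj_classes G. \<forall>g \<in> K. character G \<gamma> g = of_int z} - 1"
  obtains x where "x \<in> carrier (int_lattice l)" "cartan_transpose l n M x = (\<lambda>i. (int n - z) * x i)"
    "\<exists>i. x i \<noteq> 0" "\<forall>i\<in>S. x i = 0"
proof -
  define T where "T = {K \<in> conj_classes G. \<forall>g \<in> K. character G \<gamma> g = of_int z}"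
  define cl where "cl g = {inv h \<otimes> g \<otimes> h | h. h \<in> carrier G}" for g
  have classes: "conj_classes G = cl ` carrier G" by (simp add: conj_classes_def cl_def)
  have finT: "finite T" unfolding T_def classes using fin by simp
  have mem_cl: "g \<in> cl g" if "g \<in> carrier G" for g
    using that by (auto simp: cl_def intro!: exI[of _ \<one>])
  have cl_conj: "cl (inv h \<otimes> g \<otimes> h) = cl g" if g: "g \<in> carrier G" and h: "h \<in> carrier G" for g h
  proof -
    have "cl (inv h \<otimes> g \<otimes> h) \<subseteq> cl g" if g: "g \<in> carrier G" and h: "h \<in> carrier G" for g h
    proof
      fix y assume "y \<in> cl (inv h \<otimes> g \<otimes> h)"
      then obtain k where k: "k \<in> carrier G" "y = inv k \<otimes> (inv h \<otimes> g \<otimes> h) \<otimes> k" by (auto simp: cl_def)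
      then have "y = inv (h \<otimes> k) \<otimes> g \<otimes> (h \<otimes> k)" using g h by (simp add: m_assoc inv_mult_group)
      then show "y \<in> cl g" using k h by (auto simp: cl_def)
    qed
    note sub = this
    have "inv (inv h) \<otimes> (inv h \<otimes> g \<otimes> h) \<otimes> inv h = g"
    proof -
      have "h \<otimes> (inv h \<otimes> (g \<otimes> (h \<otimes> inv h))) = (h \<otimes> inv h) \<otimes> g"
        using g h by (simp add: m_assoc[symmetric] del: r_inv)
      then show ?thesis using g h by (simp add: m_assoc)
    qed
    then have "cl g \<subseteq> cl (inv h \<otimes> g \<otimes> h)" using sub[of "inv h \<otimes> g \<otimes> h" "inv h"] g h by simp
    then show ?thesis using sub[OF g h] by blast
  qed
  \<comment> \<open>The extra equation at index 0 puts the vector into \<open>int_lattice\<close>;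
    the -1 in the bound on \<open>S\<close> pays for it. Indices above \<open>l\<close> need no
    equation, as \<open>v\<close> is 0 there.\<close>
  define S' where "S' = insert 0 (S \<inter> {0..l})"
  have "card S' \<le> Suc (card S)"
    using S card_mono[of S "S \<inter> {0..l}"] by (auto simp: S'_def card_insert_if)
  then have "card S' < card T" using card by (simp add: T_def)
  moreover have "finite S'" using S by (simp add: S'_def)
  ultimately obtain f where f: "\<exists>K\<in>T. f K \<noteq> 0"
    "\<forall>i\<in>S'. (\<Sum>K\<in>T. (\<Sum>g\<in>{g \<in> carrier G. cl g = K}. chi i g) * f K) = 0"
    using underdetermined_system[OF _ finT, of S' "\<lambda>i K. \<Sum>g\<in>{g \<in> carrier G. cl g = K}. chi i g"]
    by blast
  \<comment> \<open>The weights \<open>f K\<close> spread over the classes as a class function;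
    \<open>v\<close> is the resulting combination of columns of the character table, each scaled by
    its class size.\<close>
  define F where "F g = (if cl g \<in> T then f (cl g) else 0)" for g
  define v where "v i = (if i \<le> l then \<Sum>g\<in>carrier G. F g * chi i g else 0)" for i
  have v: "v i = (\<Sum>K\<in>T. (\<Sum>g\<in>{g \<in> carrier G. cl g = K}. chi i g) * f K)" if "i \<le> l" for i
  proof -
    define A where "A = {g \<in> carrier G. cl g \<in> T}"
    have "v i = (\<Sum>g\<in>A. f (cl g) * chi i g)"
      using that fin unfolding v_def F_def A_def
      by (simp add: sum.If_cases if_distrib[of "\<lambda>y. y * _"] Int_def cong: if_cong)
    also have "\<dots> = (\<Sum>K\<in>T. \<Sum>g\<in>{g \<in> A. cl g = K}. f (cl g) * chi i g)"
      using fin finT by (intro sum.group[symmetric]) (auto simp: A_def)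
    also have "\<dots> = (\<Sum>K\<in>T. (\<Sum>g\<in>{g \<in> carrier G. cl g = K}. chi i g) * f K)"
    proof (rule sum.cong)
      fix K assume "K \<in> T"
      then have "{g \<in> A. cl g = K} = {g \<in> carrier G. cl g = K}" by (auto simp: A_def)
      then show "(\<Sum>g\<in>{g \<in> A. cl g = K}. f (cl g) * chi i g) =
          (\<Sum>g\<in>{g \<in> carrier G. cl g = K}. chi i g) * f K"
        unfolding sum_distrib_right by (intro sum.cong) auto
    qed simp
    finally show ?thesis .
  qed
  have vS: "v i = 0" if "i \<in> S \<or> i = 0" for i
  proof (cases "i \<le> l")
    case True
    then show ?thesis using f(2) v[OF True] that by (auto simp: S'_def)
  qed (simp add: v_def)
  \<comment> \<open>If all pairings vanished, completeness of the irreducible characters would force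
    \<open>F\<close> to be 0.\<close>
  have "\<exists>i\<in>{0..l}. v i \<noteq> 0"
  proof (rule ccontr)
    assume v0: "\<not> (\<exists>i\<in>{0..l}. v i \<noteq> 0)"
    obtain K where K: "K \<in> T" "f K \<noteq> 0" using f(1) by blast
    then obtain g where g: "g \<in> carrier G" "K = cl g" by (auto simp: T_def classes)
    have "F g = 0"
    proof (rule class_function_zero[OF fin _ _ g(1)])
      show "F (inv h \<otimes> g \<otimes> h) = F g" if "g \<in> carrier G" "h \<in> carrier G" for g h
        using cl_conj[OF that] by (simp add: F_def)
      fix d \<rho> assume "irreducible_rep G d \<rho>"
      then have "character G \<rho> \<in> chi ` {0..l}"
        using irr by (auto simp: bij_betw_def irr_chars_def)
      then obtain i where i: "i \<le> l" "chi i = character G \<rho>" by auto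
      have "(\<Sum>g\<in>carrier G. F g * mat_trace (\<rho> g)) = v i"
        using i by (simp add: v_def) (auto simp: character_def intro!: sum.cong)
      then show "(\<Sum>g\<in>carrier G. F g * mat_trace (\<rho> g)) = 0" using v0 i by simp
    qed
    then show False using K g by (simp add: F_def)
  qed
  then obtain i0 where i0: "i0 \<in> {0..l}" "v i0 \<noteq> 0" by blast
  define B where "B i j = M i j - (if j = i then z else 0)" for i j
  have ker: "(\<Sum>j\<in>{0..l}. of_int (B i j) * v j) = 0" if i: "i \<in> {0..l}" for i
  proof -
    have "(\<Sum>j\<in>{0..l}. of_int (B i j) * v j) = (\<Sum>j\<in>{0..l}. of_int (M i j) * v j) - of_int z * v i"
    proof -
      have "(\<Sum>j\<in>{0..l}. of_int (B i j) * v j) =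
          (\<Sum>j\<in>{0..l}. of_int (M i j) * v j - (if j = i then of_int z * v j else 0))"
        by (intro sum.cong) (auto simp: B_def algebra_simps)
      then show ?thesis using i by (simp add: sum_subtractf)
    qed
    also have "(\<Sum>j\<in>{0..l}. of_int (M i j) * v j) =
        (\<Sum>j\<in>{0..l}. \<Sum>g\<in>carrier G. F g * (of_int (M i j) * chi j g))"
      by (intro sum.cong) (auto simp: v_def sum_distrib_left mult_ac)
    also have "\<dots> = (\<Sum>g\<in>carrier G. F g * (\<Sum>j\<in>{0..l}. of_int (M i j) * chi j g))"
      unfolding sum_distrib_left by (rule sum.swap)
    also have "\<dots> = (\<Sum>g\<in>carrier G. of_int z * (F g * chi i g))"
    proof (rule sum.cong)
      fix g assume g: "g \<in> carrier G"
      \<comment> \<open>On the support of \<open>F\<close> the character equals z, so multiplying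
        \<open>F\<close> by the character is multiplying it by z.\<close>
      have "character G \<gamma> g = of_int z" if "cl g \<in> T" using that mem_cl[OF g] by (auto simp: T_def)
      then show "F g * (\<Sum>j\<in>{0..l}. of_int (M i j) * chi j g) = of_int z * (F g * chi i g)"
        using M_eq i g by (auto simp: F_def simp flip: M_eq)
    qed simp
    also have "\<dots> = of_int z * v i" using i by (simp add: v_def sum_distrib_left)
    finally show ?thesis by simp
  qed
  obtain x where x: "\<exists>j\<in>{0..l}. x j \<noteq> 0" "\<And>j. v j = 0 \<Longrightarrow> x j = 0"
    "\<And>i. i \<in> {0..l} \<Longrightarrow> (\<Sum>j\<in>{0..l}. B i j * x j) = 0"
    using integer_kernel_vector[of "{0..l}" i0 v "{0..l}" B] i0 ker by (simp only: finite_atLeastAtMost) blast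
  have x0: "x 0 = 0" using x(2) vS by simp
  have lattice: "x \<in> carrier (int_lattice l)"
    using x(2) vS by (auto simp: int_lattice_simps v_def not_less_eq_eq)
  have "cartan_transpose l n M x i = (int n - z) * x i" for i
  proof (cases "i \<in> {1..l}")
    case True
    have "(\<Sum>j\<in>{0..l}. B i j * x j) = (\<Sum>j\<in>{1..l}. B i j * x j)"
      by (rule sum.mono_neutral_right) (auto simp: x0 not_less_eq_eq)
    then have 0: "(\<Sum>j\<in>{1..l}. B i j * x j) = 0" using x(3)[of i] True by simp
    \<comment> \<open>Symmetry of \<open>M\<close> enters here: the kernel equation runs along row i
      of \<open>M\<close>, the transposed Cartan matrix along column i.\<close>
    have "(\<Sum>j\<in>{1..l}. ext_mckay_cartan n M j i * x j) =
        (\<Sum>j\<in>{1..l}. (if j = i then (int n - z) * x j else 0) - B i j * x j)"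
      using True M_symmetric by (intro sum.cong) (auto simp: ext_mckay_cartan_def B_def algebra_simps)
    also have "\<dots> = (int n - z) * x i" using True 0 by (simp add: sum_subtractf)
    finally show ?thesis using True by (simp add: cartan_transpose_def)
  next
    case False
    then show ?thesis using lattice by (auto simp: cartan_transpose_def int_lattice_simps)
  qed
  then show ?thesis using that lattice x(1,2) vS by blast
qed

lemma character_le_dim:
  assumes "c \<in> carrier G" "character G \<gamma> c = of_int z"
  shows "z \<le> int n"
  using rep_trace_properties(2)[OF fin rep assms(1)] assms by (simp add: character_def)

lemma critical_group_eigenvalue_subgroup:
  assumes c: "c \<in> carrier G" "character G \<gamma> c = of_int z"
  defines "r \<equiv> card {K \<in> conj_classes G. \<forall>g \<in> K. character G \<gamma> g = of_int z} - 1"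
  shows "\<exists>H. subgroup H (critical_group l n M) \<and>
    (critical_group l n M)\<lparr>carrier := H\<rparr> \<cong> product_group {..<r} (\<lambda>_. integer_mod_group (nat (int n - z)))"
proof -
  define k where "k = int n - z"
  \<comment> \<open>A character value has real part at most n, so \<open>nat\<close> truncates
    nothing.\<close>
  have k: "int (nat k) = k" using character_le_dim[OF c] by (simp add: k_def)
  define E where "E = {x \<in> carrier (int_lattice l). cartan_transpose l n M x = (\<lambda>i. k * x i)}"
  have lin: "(\<lambda>i. a * x i + b * y i) \<in> E" if "x \<in> E" "y \<in> E" for x y a b
    using that unfolding E_def
    by (auto simp: cartan_transpose_linear int_lattice_simps algebra_simps)
  have "\<exists>w. (\<forall>j<r. w j \<in> E) \<and>
    (\<forall>k u a. u \<in> E \<longrightarrow> (\<forall>i. (\<Sum>j<r. a j * w j i) = k * u i) \<longrightarrow> (\<forall>j<r. k dvd a j))"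
  proof (rule saturated_lattice_basis[OF lin])
    fix S :: "nat set" assume S: "finite S" "card S < r"
    obtain x where "x \<in> carrier (int_lattice l)" "cartan_transpose l n M x = (\<lambda>i. (int n - z) * x i)"
      "\<exists>i. x i \<noteq> 0" "\<forall>i\<in>S. x i = 0"
      by (rule integer_eigenvector[OF S(1) S(2)[unfolded r_def]])
    then show "\<exists>x\<in>E. (\<exists>i. x i \<noteq> 0) \<and> (\<forall>i\<in>S. x i = 0)"
      by (intro bexI[of _ x]) (auto simp: E_def k_def)
  qed
  then obtain w where w: "\<And>j. j < r \<Longrightarrow> w j \<in> E"
    and basis: "\<And>k u a j. u \<in> E \<Longrightarrow> \<forall>i. (\<Sum>j<r. a j * w j i) = k * u i \<Longrightarrow> j < r \<Longrightarrow> k dvd a j"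
    by blast
  have sum_E: "(\<lambda>i. \<Sum>j<r. a j * w j i) \<in> E" for a
  proof -
    have "(\<lambda>i. \<Sum>j<m. a j * w j i) \<in> E" if "m \<le> r" for m
      using that
    proof (induction m)
      case 0
      show ?case by (auto simp: E_def int_lattice_simps cartan_transpose_def)
    next
      case (Suc m)
      then show ?case using lin[of "\<lambda>i. \<Sum>j<m. a j * w j i" "w m" 1 "a m"] w by simp
    qed
    then show ?thesis by simp
  qed
  have "\<exists>H. subgroup H (critical_group l n M) \<and>
    (critical_group l n M)\<lparr>carrier := H\<rparr> \<cong> product_group {..<r} (\<lambda>_. integer_mod_group (nat k))"
  proof (rule critical_group_power_subgroup[where w = w])
    show "w j \<in> carrier (int_lattice l)" if "j < r" for j using w[OF that] by (simp add: E_def)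
    show "(\<lambda>i. \<Sum>j<r. a j * w j i) \<in> mckay_cartan_transpose_image l n M \<longleftrightarrow> (\<forall>j<r. int (nat k) dvd a j)"
      for a unfolding k
    proof
      assume "(\<lambda>i. \<Sum>j<r. a j * w j i) \<in> mckay_cartan_transpose_image l n M"
      then obtain y where y: "y \<in> carrier (int_lattice l)"
        "(\<lambda>i. \<Sum>j<r. a j * w j i) = cartan_transpose l n M y"
        unfolding mckay_cartan_transpose_image_eq by blast
      have "cartan_transpose l n M (cartan_transpose l n M y) = (\<lambda>i. k * cartan_transpose l n M y i)"
        using sum_E[of a] unfolding y(2) by (simp add: E_def)
      then have "cartan_transpose l n M (\<lambda>i. 1 * cartan_transpose l n M y i + (- k) * y i) = (\<lambda>_. 0)"
        unfolding cartan_transpose_linear by simp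
      moreover have "(\<lambda>i. 1 * cartan_transpose l n M y i + (- k) * y i) \<in> carrier (int_lattice l)"
        using y(1) by (auto simp: int_lattice_simps cartan_transpose_def)
      ultimately have "(\<lambda>i. 1 * cartan_transpose l n M y i + (- k) * y i) = (\<lambda>_. 0)"
        by (rule cartan_transpose_injective[rotated])
      from fun_cong[OF this] have eq: "cartan_transpose l n M y = (\<lambda>i. k * y i)" by auto
      then have "y \<in> E" using y(1) by (simp add: E_def)
      moreover have "\<forall>i. (\<Sum>j<r. a j * w j i) = k * y i" using fun_cong[OF y(2)] eq by simp
      ultimately show "\<forall>j<r. k dvd a j" using basis by blast
    next
      assume "\<forall>j<r. k dvd a j"
      then obtain b where b: "\<And>j. j < r \<Longrightarrow> a j = k * b j" unfolding dvd_def by metis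
      \<comment> \<open>On \<open>E\<close> the transposed Cartan matrix is multiplication by
        \<open>k\<close>, so a k-fold element of \<open>E\<close> is an image.\<close>
      have "(\<lambda>i. \<Sum>j<r. a j * w j i) = cartan_transpose l n M (\<lambda>i. \<Sum>j<r. b j * w j i)"
        using sum_E[of b] by (simp add: E_def sum_distrib_left b mult.assoc)
      moreover have "(\<lambda>i. \<Sum>j<r. b j * w j i) \<in> carrier (int_lattice l)"
        using sum_E[of b] by (simp add: E_def)
      ultimately show "(\<lambda>i. \<Sum>j<r. a j * w j i) \<in> mckay_cartan_transpose_image l n M"
        unfolding mckay_cartan_transpose_image_eq by blast
    qed
  qed
  then show ?thesis by (simp add: k_def)
qed

end

theorem theorem1:
  fixes G :: "('g, 'b) monoid_scheme"
    and n :: nat and \<gamma> :: "'g \<Rightarrow> complex mat"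
    and l :: nat and chi :: "nat \<Rightarrow> 'g \<Rightarrow> complex"
    and M :: "nat \<Rightarrow> nat \<Rightarrow> int"
    and c :: 'g and z :: int
  assumes "group G" and "finite (carrier G)"
    and "faithful_rep G n \<gamma>"
    and "\<forall>g \<in> carrier G. character G \<gamma> g \<in> \<real>"
    and "bij_betw chi {0..l} (irr_chars G)"
    and "chi 0 = trivial_char G"
    and "\<forall>i \<in> {0..l}. \<forall>g \<in> carrier G.
           character G \<gamma> g * chi i g = (\<Sum>j\<in>{0..l}. of_int (M i j) * chi j g)"
    and "c \<in> carrier G"
    and "character G \<gamma> c = of_int z"
  shows "\<exists>H. subgroup H (critical_group l n M) \<and>
           (critical_group l n M)\<lparr>carrier := H\<rparr> \<cong>
             product_group {..< card {K \<in> conj_classes G. \<forall>g \<in> K. character G \<gamma> g = character G \<gamma> c} - 1}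
               (\<lambda>_. integer_mod_group (nat (int n - z)))"
proof -
  interpret mckay_data G n \<gamma> l chi M
    using assms by (simp add: mckay_data_def mckay_data_axioms_def)
  show ?thesis
    using critical_group_eigenvalue_subgroup[OF assms(8,9)] unfolding assms(9) .
qed

end
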